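(* Let $n\ge 1$ and let $M_n=X_1+\dots+X_n$ be a martingale with respect to a filtration $\mathcal F_0\subset\mathcal F_1\subset\dots\subset\mathcal F_n$ (with $M_0=X_0=0$), whose differences satisfy $X_k\le 1$ almost surely for $k=1,\dots,n$. Let $g_k$ be the conditional skewness of $X_k$ given $\mathcal F_{k-1}$, and assume that there are non-random real numbers $\gamma_1,\dots,\gamma_n$ with $$g_k\ge\gamma_k \quad\text{almost surely},\qquad k=1,2,\dots,n.$$ Let $u(x)=\sqrt{1+x^2/4}-x/2$ for $x\in\mathbb R$, and put $$\gamma=\frac{1}{\sqrt n}\,\frac{\gamma_1u(\gamma_1)+\dots+\gamma_nu(\gamma_n)}{\sqrt{u^2(\gamma_1)+\dots+u^2(\gamma_n)}},\qquad \sigma^2=\frac{u^2(\gamma_1)+\dots+u^2(\gamma_n)}{n}.$$ Then the Bernoulli random variable $\varepsilon=\varepsilon(\sigma^2)$ has variance $\sigma^2$ and skewness $\gamma$, and, if $T_n$ is a sum of $n$ independent copies of $\varepsilon(\sigma^2)$, then for every $x\in\mathbb R$ $$\mathbb P\{M_n\ge x\}\le\inf_{h>0}e^{-hx}\,\mathbb E\,e^{hT_n}\qquad\text{and}\qquad \mathbb P\{M_n\ge x\}\le\inf_{h<x}(x-h)^{-2}\,\mathbb E\,(T_n-h)_+^2 .$$ In the special case where $\gamma_1=\dots=\gamma_n=\gamma$, the Bernoulli random variable has skewness $\gamma$ and variance $\sigma^2=u^2(\gamma)$.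
   Context: For a martingale $M_k=X_1+\dots+X_k$ ($0\le k\le n$), with each $M_k$ being $\mathcal F_k$-measurable, the conditional variance and conditional skewness of the difference $X_k$ are the $\mathcal F_{k-1}$-measurable random variables $$s_k^2=\mathbb E(X_k^2\mid\mathcal F_{k-1}),\qquad g_k=\mathbb E(X_k^3\mid\mathcal F_{k-1})/s_k^3,$$ where $s_k\ge0$, it is understood that $s_k^2<\infty$ almost surely, and by convention $g_k=+\infty$ where $s_k=0$. (Since $X_k\le1$, the conditional expectation of $X_k^3$ is well defined with values in $[-\infty,1]$.) For $\sigma^2>0$, the Bernoulli random variable $\varepsilon=\varepsilon(\sigma^2)$ is the two-valued random variable with $\mathbb P\{\varepsilon=-\sigma^2\}=q$ and $\mathbb P\{\varepsilon=1\}=p$, where $q=\frac1{1+\sigma^2}$, $p=1-q=\frac{\sigma^2}{1+\sigma^2}$; it satisfies $\mathbb E\varepsilon=0$, $\mathbb E\varepsilon^2=\sigma^2$. The skewness of a mean-zero random variable $X$ with variance $\sigma^2>0$ ($\sigma>0$) is $\mathbb E X^3/\sigma^3$. Notation: $(t)_+^2=(\max\{0,t\})^2$. *)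

theory Defs
  imports "HOL-Probability.Probability"
begin

definition filtration_upto :: "'a measure \<Rightarrow> nat \<Rightarrow> (nat \<Rightarrow> 'a measure) \<Rightarrow> bool" where
  "filtration_upto M n F \<longleftrightarrow>
     (\<forall>k\<le>n. subalgebra M (F k)) \<and>
     (\<forall>i j. i \<le> j \<longrightarrow> j \<le> n \<longrightarrow> sets (F i) \<subseteq> sets (F j))"

definition martingale_upto ::
  "'a measure \<Rightarrow> nat \<Rightarrow> (nat \<Rightarrow> 'a measure) \<Rightarrow> (nat \<Rightarrow> 'a \<Rightarrow> real) \<Rightarrow> bool" where
  "martingale_upto M n F S \<longleftrightarrow>
     filtration_upto M n F \<and>
     (\<forall>k\<le>n. S k \<in> borel_measurable (F k) \<and> integrable M (S k)) \<and>
     (\<forall>i j. i \<le> j \<longrightarrow> j \<le> n \<longrightarrow> (AE \<omega> in M. real_cond_exp M (F i) (S j) \<omega> = S i \<omega>))"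

text \<open>Square integrability is not assumed, so the conditional variance is a priori
  \<open>[0, \<infinity>]\<close>-valued.\<close>

definition cond_var :: "'a measure \<Rightarrow> 'a measure \<Rightarrow> ('a \<Rightarrow> real) \<Rightarrow> 'a \<Rightarrow> ennreal" where
  "cond_var M G X = nn_cond_exp M G (\<lambda>\<omega>. ennreal ((X \<omega>)\<^sup>2))"

text \<open>The junk value \<open>0\<close> is taken where the conditional variance is infinite; below this is
  always a null event.\<close>

definition cond_sd :: "'a measure \<Rightarrow> 'a measure \<Rightarrow> ('a \<Rightarrow> real) \<Rightarrow> 'a \<Rightarrow> real" where
  "cond_sd M G X \<omega> = sqrt (enn2real (cond_var M G X \<omega>))"

text \<open>Conditional expectation with extended real values, as the difference of the conditional
  expectations of the positive and negative parts (\<^const>\<open>ennreal\<close> sends negative reals to \<open>0\<close>).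
  It is meaningful where one of the two is finite; for \<open>f = X ^ 3\<close> with \<open>X \<le> 1\<close> the first one is
  at most \<open>1\<close>. In contrast, \<^const>\<open>real_cond_exp\<close> would replace the value \<open>-\<infinity>\<close> by a finite one.\<close>

definition ereal_cond_exp :: "'a measure \<Rightarrow> 'a measure \<Rightarrow> ('a \<Rightarrow> real) \<Rightarrow> 'a \<Rightarrow> ereal" where
  "ereal_cond_exp M G f \<omega> =
     enn2ereal (nn_cond_exp M G (\<lambda>\<omega>. ennreal (f \<omega>)) \<omega>) -
     enn2ereal (nn_cond_exp M G (\<lambda>\<omega>. ennreal (- f \<omega>)) \<omega>)"

definition cond_skewness :: "'a measure \<Rightarrow> 'a measure \<Rightarrow> ('a \<Rightarrow> real) \<Rightarrow> 'a \<Rightarrow> ereal" where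
  "cond_skewness M G X \<omega> =
     (if cond_sd M G X \<omega> = 0 then \<infinity>
      else ereal_cond_exp M G (\<lambda>\<omega>. X \<omega> ^ 3) \<omega> / ereal (cond_sd M G X \<omega> ^ 3))"

text \<open>For mean-zero random variables with positive variance.\<close>

definition skewness :: "'a measure \<Rightarrow> ('a \<Rightarrow> real) \<Rightarrow> real" where
  "skewness N X =
     prob_space.expectation N (\<lambda>\<omega>. X \<omega> ^ 3) / sqrt (prob_space.variance N X) ^ 3"

text \<open>\<open>\<epsilon>\<close> is a Bernoulli random variable \<open>\<epsilon>(v)\<close> (with \<open>v = \<sigma>\<^sup>2\<close>) on the probability space \<open>N\<close>.\<close>

definition bernoulli_rv :: "'a measure \<Rightarrow> real \<Rightarrow> ('a \<Rightarrow> real) \<Rightarrow> bool" where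
  "bernoulli_rv N v \<epsilon> \<longleftrightarrow>
     \<epsilon> \<in> borel_measurable N \<and>
     measure N {\<omega> \<in> space N. \<epsilon> \<omega> = - v} = 1 / (1 + v) \<and>
     measure N {\<omega> \<in> space N. \<epsilon> \<omega> = 1} = v / (1 + v)"

definition u :: "real \<Rightarrow> real" where
  "u x = sqrt (1 + x\<^sup>2 / 4) - x / 2"

definition avg_var :: "nat \<Rightarrow> (nat \<Rightarrow> real) \<Rightarrow> real" where
  "avg_var n \<gamma> = (\<Sum>k=1..n. (u (\<gamma> k))\<^sup>2) / real n"

definition avg_skew :: "nat \<Rightarrow> (nat \<Rightarrow> real) \<Rightarrow> real" where
  "avg_skew n \<gamma> =
     1 / sqrt (real n) * ((\<Sum>k=1..n. \<gamma> k * u (\<gamma> k)) / sqrt (\<Sum>k=1..n. (u (\<gamma> k))\<^sup>2))"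

end

theory Submission
  imports Defs
begin

text \<open>Taking conditional expectations in \<open>(1 - X\<^sub>k) (X\<^sub>k + s\<^sub>k\<^sup>2)\<^sup>2 \<ge> 0\<close> gives
  \<open>E(X\<^sub>k\<^sup>3 | F\<^sub>k\<^sub>-\<^sub>1) \<le> s\<^sub>k\<^sup>2 - s\<^sub>k\<^sup>4\<close>, so \<open>g\<^sub>k \<ge> \<gamma>\<^sub>k\<close> forces \<open>s\<^sub>k\<^sup>2 + \<gamma>\<^sub>k s\<^sub>k \<le> 1\<close>, that is,
  \<open>s\<^sub>k \<le> u(\<gamma>\<^sub>k)\<close>. A parabola touching \<open>(x - h)\<^sub>+\<^sup>2\<close> at the atoms of \<open>\<epsilon>(v)\<close> then allows one to replace the
  differences, one at a time, by independent Bernoulli variables of variance \<open>u\<^sup>2(\<gamma>\<^sub>k)\<close>. With the sum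
  \<open>a + b\<close> fixed, \<open>E(\<epsilon>(a) + \<epsilon>(b) - h)\<^sub>+\<^sup>2\<close> grows as \<open>a\<close> and \<open>b\<close> get closer, so all variances may be
  replaced by their average, and Markov's inequality gives the quadratic bound. The exponential bound
  follows from it, since \<open>e\<^sup>l\<^sup>t\<close> is a positive mixture of the functions \<open>(t - s)\<^sub>+\<^sup>2\<close>.\<close>

section \<open>Averaging the variances of Bernoulli sums\<close>

text \<open>If \<open>g h = E(Y - h)\<^sub>+\<^sup>2\<close>, then \<open>bern v g h = E(Y + \<epsilon>(v) - h)\<^sub>+\<^sup>2\<close> for \<open>\<epsilon>(v)\<close> independent of \<open>Y\<close>.
  Folding \<open>bern\<close> over a multiset of variances, starting from \<open>pos_sq\<close> (the case \<open>Y = 0\<close>), thus encodes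
  a sum of independent Bernoulli variables without a probability space.\<close>

definition bern :: "real \<Rightarrow> (real \<Rightarrow> real) \<Rightarrow> real \<Rightarrow> real" where
  "bern v g h = (g (h + v) + v * g (h - 1)) / (1 + v)"

lemma bern_bern:
  "bern a (bern b g) h =
     (g (h + a + b) + b * g (h + a - 1) + a * g (h + b - 1) + a * b * g (h - 2)) / ((1 + a) * (1 + b))"
proof -
  have "bern a (bern b g) h = ((g (h + a + b) + b * g (h + a - 1)) / (1 + b)
      + a * ((g (h + b - 1) + b * g (h - 2)) / (1 + b))) / (1 + a)"
    by (simp add: bern_def algebra_simps)
  also have "\<dots> = (g (h + a + b) + b * g (h + a - 1) + a * g (h + b - 1) + a * b * g (h - 2)) / ((1 + a) * (1 + b))"
    by (simp add: add_divide_distrib distrib_left mult_ac)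
  finally show ?thesis .
qed

text \<open>The four-term formula in \<open>bern_bern\<close> is symmetric in \<open>a\<close> and
  \<open>b\<close>, because the order in which independent summands are added is irrelevant. This
  makes the fold over a multiset well behaved.\<close>

lemma bern_commute: "bern a (bern b g) = bern b (bern a g)"
  by (rule ext) (simp add: bern_bern algebra_simps)

interpretation bern: comp_fun_commute bern
  by unfold_locales (simp add: fun_eq_iff bern_commute)

lemma bern_mono:
  assumes "v \<ge> 0" and "g \<le> g'"
  shows "bern v g \<le> bern v g'"
  using assms by (auto simp: bern_def le_fun_def intro!: divide_right_mono add_mono mult_left_mono)

lemma fold_bern_mono:
  assumes "\<And>v. v \<in># A \<Longrightarrow> v \<ge> 0" and "g \<le> g'"
  shows "fold_mset bern g A \<le> fold_mset bern g' A"
  using assms by (induction A) (auto intro!: bern_mono)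

section \<open>Two Bernoulli variables with a fixed total variance\<close>

definition pos_sq :: "real \<Rightarrow> real" where
  "pos_sq h = (max 0 (- h))\<^sup>2"

lemma pos_sq_simps: "h \<le> 0 \<Longrightarrow> pos_sq h = h\<^sup>2" "h \<ge> 0 \<Longrightarrow> pos_sq h = 0"
  by (simp_all add: pos_sq_def max_def)

text \<open>The sum of the two variables has the atoms -(a+b) <= 1-b <= 1-a <= 2. This lemma and the
  next four treat the five intervals cut out by these atoms. Only atoms above \<open>h\<close>
  contribute, so on each interval a single closed form holds; at a shared endpoint both neighbouring
  forms are available.\<close>

lemma bern_bern_pos_sq_high:
  assumes "0 \<le> a" "a \<le> b" "1 - a \<le> h" "h \<le> 2"
  shows "bern a (bern b pos_sq) h = (2 - h)\<^sup>2 * (1 - (1 + a + b) / ((1 + a) * (1 + b)))"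
proof -
  have "pos_sq (h + a + b) = 0" "pos_sq (h + a - 1) = 0" "pos_sq (h + b - 1) = 0" "pos_sq (h - 2) = (2 - h)\<^sup>2"
    using assms by (simp_all add: pos_sq_simps power2_commute)
  moreover have "1 + a \<noteq> 0" "1 + b \<noteq> 0" using assms by auto
  ultimately show ?thesis
    by (simp add: bern_bern divide_simps) (simp add: algebra_simps)
qed

lemma bern_bern_pos_sq_mid:
  assumes "0 \<le> a" "a \<le> b" "1 - b \<le> h" "h \<le> 1 - a"
  shows "bern a (bern b pos_sq) h = b * (a + (1 - h)\<^sup>2) / (1 + b)"
proof -
  have "pos_sq (h + a + b) = 0" "pos_sq (h + a - 1) = (h + a - 1)\<^sup>2" "pos_sq (h + b - 1) = 0" "pos_sq (h - 2) = (h - 2)\<^sup>2"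
    using assms by (simp_all add: pos_sq_simps)
  moreover have "1 + a \<noteq> 0" "1 + b \<noteq> 0" using assms by auto
  ultimately show ?thesis
    by (simp add: bern_bern divide_simps) (simp add: algebra_simps power2_eq_square)
qed

lemma bern_bern_pos_sq_low:
  assumes "0 \<le> a" "a \<le> b" "- (a + b) \<le> h" "h \<le> 1 - b"
  shows "bern a (bern b pos_sq) h = a + b + h\<^sup>2 - (a + b + h)\<^sup>2 / ((1 + a) * (1 + b))"
proof -
  have "pos_sq (h + a + b) = 0" "pos_sq (h + a - 1) = (h + a - 1)\<^sup>2"
    "pos_sq (h + b - 1) = (h + b - 1)\<^sup>2" "pos_sq (h - 2) = (h - 2)\<^sup>2"
    using assms by (simp_all add: pos_sq_simps)
  moreover have "1 + a \<noteq> 0" "1 + b \<noteq> 0" using assms by auto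
  ultimately show ?thesis
    by (simp add: bern_bern divide_simps) (simp add: algebra_simps power2_eq_square)
qed

lemma bern_bern_pos_sq_lowest:
  assumes "0 \<le> a" "a \<le> b" "h \<le> - (a + b)"
  shows "bern a (bern b pos_sq) h = a + b + h\<^sup>2"
proof -
  have "pos_sq (h + a + b) = (h + a + b)\<^sup>2" "pos_sq (h + a - 1) = (h + a - 1)\<^sup>2"
    "pos_sq (h + b - 1) = (h + b - 1)\<^sup>2" "pos_sq (h - 2) = (h - 2)\<^sup>2"
    using assms by (simp_all add: pos_sq_simps)
  moreover have "1 + a \<noteq> 0" "1 + b \<noteq> 0" using assms by auto
  ultimately show ?thesis
    by (simp add: bern_bern divide_simps) (simp add: algebra_simps power2_eq_square)
qed

lemma bern_bern_pos_sq_highest: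
  assumes "0 \<le> a" "a \<le> b" "2 \<le> h"
  shows "bern a (bern b pos_sq) h = 0"
  using assms by (simp add: bern_def pos_sq_simps)

lemma prod_mono_of_sum_eq:
  fixes a b c d :: real
  assumes "a + b = c + d" "a \<le> c" "c \<le> d"
  shows "(1 + a) * (1 + b) \<le> (1 + c) * (1 + d)"
proof -
  have "(1 + c) * (1 + d) - (1 + a) * (1 + b) = (c - a) * (d - a)"
    using assms(1) by algebra
  moreover have "(c - a) * (d - a) \<ge> 0" using assms by simp
  ultimately show ?thesis by linarith
qed

text \<open>With the sum fixed, the closed form depends on the pair only through the product
  (1+a)(1+b), and it increases in that product. The low interval is handled in the same way.\<close>

lemma bern_bern_pos_sq_high_le:
  assumes "0 \<le> a" "a \<le> c" "c \<le> d" "a + b = c + d" "1 - a \<le> h" "h \<le> 2"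
  shows "bern a (bern b pos_sq) h \<le> bern c (bern d pos_sq) h"
proof -
  have "(1 + c + d) / ((1 + c) * (1 + d)) \<le> (1 + a + b) / ((1 + a) * (1 + b))"
    using prod_mono_of_sum_eq[of a b c d] assms by (auto intro!: frac_le)
  moreover have "bern a (bern b pos_sq) h = (2 - h)\<^sup>2 * (1 - (1 + a + b) / ((1 + a) * (1 + b)))"
    using assms by (intro bern_bern_pos_sq_high) auto
  moreover have "bern c (bern d pos_sq) h = (2 - h)\<^sup>2 * (1 - (1 + c + d) / ((1 + c) * (1 + d)))"
    using assms by (intro bern_bern_pos_sq_high) auto
  ultimately show ?thesis by (auto intro!: mult_left_mono)
qed

text \<open>Here both pairs are in their middle interval. After cross-multiplication the difference
  factors as (b-d)(d + b + db - (c+d+K)). The second factor is nonnegative since 0 <= 1-h <= d gives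
  K <= d^2 <= db, and c <= d <= b.\<close>

lemma bern_bern_pos_sq_mid_le:
  assumes "0 \<le> a" "a \<le> c" "c \<le> d" "a + b = c + d" "1 - d \<le> h" "h \<le> 1 - c"
  shows "bern a (bern b pos_sq) h \<le> bern c (bern d pos_sq) h"
proof -
  define K where "K = (1 - h)\<^sup>2"
  have bd: "b \<ge> d" using assms by simp
  have "K \<le> d\<^sup>2" unfolding K_def using assms by (intro power_mono) auto
  moreover have "d\<^sup>2 \<le> d * b" using bd assms by (simp add: power2_eq_square mult_left_mono)
  ultimately have "c + d + K \<le> d + b + d * b" using assms by linarith
  then have "(b - d) * (d + b + d * b - (c + d + K)) \<ge> 0" using bd by simp
  moreover have "d * (c + K) * (1 + b) - b * (a + K) * (1 + d) = (b - d) * (d + b + d * b - (c + d + K))"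
    using assms(4) by algebra
  ultimately have "b * (a + K) / (1 + b) \<le> d * (c + K) / (1 + d)"
    using assms by (auto simp: divide_simps)
  moreover have "bern a (bern b pos_sq) h = b * (a + K) / (1 + b)"
    unfolding K_def using assms by (intro bern_bern_pos_sq_mid) auto
  moreover have "bern c (bern d pos_sq) h = d * (c + K) / (1 + d)"
    unfolding K_def using assms by (intro bern_bern_pos_sq_mid) auto
  ultimately show ?thesis by simp
qed

lemma bern_bern_pos_sq_low_le:
  assumes "0 \<le> a" "a \<le> c" "c \<le> d" "a + b = c + d" "- (a + b) \<le> h" "h \<le> 1 - b"
  shows "bern a (bern b pos_sq) h \<le> bern c (bern d pos_sq) h"
proof -
  have "(c + d + h)\<^sup>2 / ((1 + c) * (1 + d)) \<le> (a + b + h)\<^sup>2 / ((1 + a) * (1 + b))"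
    using prod_mono_of_sum_eq[of a b c d] assms by (auto intro!: frac_le)
  moreover have "bern a (bern b pos_sq) h = a + b + h\<^sup>2 - (a + b + h)\<^sup>2 / ((1 + a) * (1 + b))"
    using assms by (intro bern_bern_pos_sq_low) auto
  moreover have "bern c (bern d pos_sq) h = c + d + h\<^sup>2 - (c + d + h)\<^sup>2 / ((1 + c) * (1 + d))"
    using assms by (intro bern_bern_pos_sq_low) auto
  ultimately show ?thesis using assms by simp
qed

lemma bern_bern_pos_sq_le_ordered:
  assumes "0 \<le> a" "a \<le> c" "c \<le> d" "a + b = c + d"
  shows "bern a (bern b pos_sq) h \<le> bern c (bern d pos_sq) h"
proof -
  let ?s = "a + b"
  \<comment> \<open>The breakpoints of the two pairs interlace as -(a+b) <= 1-b <= 1-d <= 1-c <= 1-a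
    <= 2.\<close>
  consider "h \<ge> 2" | "h \<le> - ?s" | "1 - a \<le> h" "h \<le> 2" | "- ?s \<le> h" "h \<le> 1 - b"
    | "1 - c \<le> h" "h \<le> 1 - a" | "1 - d \<le> h" "h \<le> 1 - c" | "1 - b \<le> h" "h \<le> 1 - d"
    by linarith
  then show ?thesis
  proof cases
    case 1 then show ?thesis using assms by (simp add: bern_bern_pos_sq_highest)
  next
    case 2 then show ?thesis using assms by (simp add: bern_bern_pos_sq_lowest)
  next
    case 3 then show ?thesis using assms by (intro bern_bern_pos_sq_high_le)
  next
    case 4 then show ?thesis using assms by (intro bern_bern_pos_sq_low_le)
  next
    \<comment> \<open>The outer pair is in its middle interval and the inner pair in its high one,
      so no single comparison applies. The intermediate pair with smaller entry 1-h has an atom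
      exactly at \<open>h\<close>, so both closed forms hold for it. Case 7 uses the pair with
      larger entry 1-h in the same way, between low and middle.\<close>
    case 5
    have "bern a (bern b pos_sq) h \<le> bern (1 - h) (bern (?s - (1 - h)) pos_sq) h"
      using assms 5 by (intro bern_bern_pos_sq_mid_le) auto
    also have "\<dots> \<le> bern c (bern d pos_sq) h"
      using assms 5 by (intro bern_bern_pos_sq_high_le) auto
    finally show ?thesis .
  next
    case 6 then show ?thesis using assms by (intro bern_bern_pos_sq_mid_le)
  next
    case 7
    have "bern a (bern b pos_sq) h \<le> bern (?s - (1 - h)) (bern (1 - h) pos_sq) h"
      using assms 7 by (intro bern_bern_pos_sq_mid_le) auto
    also have "\<dots> \<le> bern c (bern d pos_sq) h"
      using assms 7 by (intro bern_bern_pos_sq_low_le) auto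
    finally show ?thesis .
  qed
qed

text \<open>This is the smoothing move of the averaging argument: one entry becomes exactly
  \<open>m\<close> and the other absorbs the change. The new pair can come in either order, hence
  the case distinction.\<close>

lemma bern_bern_pos_sq_le:
  assumes "0 \<le> a" "a \<le> m" "m \<le> b"
  shows "bern a (bern b pos_sq) \<le> bern m (bern (a + b - m) pos_sq)"
proof (rule le_funI)
  fix h show "bern a (bern b pos_sq) h \<le> bern m (bern (a + b - m) pos_sq) h"
  proof (cases "m \<le> a + b - m")
    case True then show ?thesis using assms by (intro bern_bern_pos_sq_le_ordered) auto
  next
    case False
    then have "bern a (bern b pos_sq) h \<le> bern (a + b - m) (bern m pos_sq) h"
      using assms by (intro bern_bern_pos_sq_le_ordered) auto
    then show ?thesis by (simp add: bern_commute)
  qed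
qed

section \<open>From pairs to arbitrarily many variances\<close>

lemma sum_mset_less:
  fixes m :: real
  assumes "A \<noteq> {#}" "\<And>a. a \<in># A \<Longrightarrow> a < m"
  shows "sum_mset A < real (size A) * m"
  using assms
proof (induction A)
  case (add x A)
  then show ?case by (cases "A = {#}") (auto simp: algebra_simps add_strict_mono)
qed simp

lemma sum_mset_greater:
  fixes m :: real
  assumes "A \<noteq> {#}" "\<And>a. a \<in># A \<Longrightarrow> m < a"
  shows "real (size A) * m < sum_mset A"
  using assms
proof (induction A)
  case (add x A)
  then show ?case by (cases "A = {#}") (auto simp: algebra_simps add_strict_mono)
qed simp

text \<open>A smoothing induction on the number of variances: an entry a <= m and another entry b >=
  m are replaced by \<open>m\<close> and a+b-m. The entry \<open>m\<close> is then peeled off, and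
  the remaining entries are nonnegative and still have mean \<open>m\<close>, so the induction
  hypothesis applies to them.\<close>

lemma fold_bern_pos_sq_le_average:
  assumes "\<And>v. v \<in># A \<Longrightarrow> v \<ge> 0" "sum_mset A = real (size A) * m"
  shows "fold_mset bern pos_sq A \<le> fold_mset bern pos_sq (replicate_mset (size A) m)"
  using assms
proof (induction "size A" arbitrary: A)
  case 0 then show ?case by simp
next
  case (Suc k)
  have "A \<noteq> {#}" using Suc.hyps(2) by auto
  then obtain a where a: "a \<in># A" "a \<le> m"
    using sum_mset_greater[of A m] Suc.prems(2) by force
  then obtain A' where A': "A = add_mset a A'" by (meson mset_add)
  show ?case
  proof (cases "A' = {#}")
    case True
    then show ?thesis using A' Suc.prems by simp
  next
    case False
    \<comment> \<open>Removing an entry a <= m leaves a multiset of mean at least \<open>m\<close>,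
      so its entries cannot all lie below \<open>m\<close>. Searching in A' rather than in
      \<open>A\<close> keeps the two occurrences distinct.\<close>
    have "\<exists>b\<in>#A'. m \<le> b"
    proof (rule ccontr)
      assume "\<not> ?thesis"
      then have "sum_mset A' < real (size A') * m" using False by (intro sum_mset_less) auto
      then show False using A' a Suc.prems(2) by (simp add: algebra_simps)
    qed
    then obtain b A'' where b: "A' = add_mset b A''" "m \<le> b" by (meson mset_add)
    let ?B = "add_mset (a + b - m) A''"
    have nn: "a \<ge> 0" "b \<ge> 0" "\<And>v. v \<in># A'' \<Longrightarrow> v \<ge> 0" using Suc.prems(1) A' b by auto
    have "m \<ge> 0" using nn a by simp
    have "fold_mset bern pos_sq A = fold_mset bern (bern a (bern b pos_sq)) A''"
      by (simp add: A' b bern.fold_mset_fun_left_comm)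
    also have "\<dots> \<le> fold_mset bern (bern m (bern (a + b - m) pos_sq)) A''"
      using nn a b by (intro fold_bern_mono bern_bern_pos_sq_le)
    also have "\<dots> = bern m (fold_mset bern pos_sq ?B)"
      by (simp add: bern.fold_mset_fun_left_comm)
    also have "\<dots> \<le> bern m (fold_mset bern pos_sq (replicate_mset (size ?B) m))"
      using nn a b Suc.hyps(2) Suc.prems(2) A' \<open>m \<ge> 0\<close>
      by (intro bern_mono Suc.hyps(1)) (auto simp: algebra_simps)
    also have "\<dots> = fold_mset bern pos_sq (replicate_mset (size A) m)"
      by (simp add: A' b)
    finally show ?thesis .
  qed
qed

section \<open>Sums of independent Bernoulli variables\<close>

context prob_space begin

text \<open>The definition prescribes only the masses of two points; v > 0 makes the points
  distinct, and the masses add up to 1.\<close>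

lemma AE_bernoulli_rv:
  assumes "bernoulli_rv M v e" "v > 0"
  shows "AE \<omega> in M. e \<omega> = - v \<or> e \<omega> = 1"
proof -
  have [measurable]: "e \<in> borel_measurable M" using assms by (simp add: bernoulli_rv_def)
  have "prob ({\<omega> \<in> space M. e \<omega> = - v} \<union> {\<omega> \<in> space M. e \<omega> = 1}) = 1 / (1 + v) + v / (1 + v)"
    using assms by (subst finite_measure_Union) (auto simp: bernoulli_rv_def)
  also have "\<dots> = 1" using assms by (simp add: field_simps)
  finally have "AE \<omega> in M. \<omega> \<in> {\<omega> \<in> space M. e \<omega> = - v} \<union> {\<omega> \<in> space M. e \<omega> = 1}"
    by (subst (asm) prob_eq_1) auto
  then show ?thesis by eventually_elim auto
qed

lemma expectation_bernoulli_rv: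
  assumes "bernoulli_rv M v e" "v > 0" and [measurable]: "g \<in> borel_measurable borel"
  shows "expectation (\<lambda>\<omega>. g (e \<omega>)) = (g (- v) + v * g 1 :: real) / (1 + v)"
proof -
  have [measurable]: "e \<in> borel_measurable M" using assms by (simp add: bernoulli_rv_def)
  let ?A = "{\<omega> \<in> space M. e \<omega> = - v}" and ?B = "{\<omega> \<in> space M. e \<omega> = 1}"
  have "expectation (\<lambda>\<omega>. g (e \<omega>)) = expectation (\<lambda>\<omega>. g (- v) * indicator ?A \<omega> + g 1 * indicator ?B \<omega>)"
    using AE_bernoulli_rv[OF assms(1,2)] AE_space assms(2)
    by (intro integral_cong_AE) (auto simp: indicator_def elim!: eventually_elim2)
  also have "\<dots> = g (- v) * prob ?A + g 1 * prob ?B"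
  proof -
    have "integrable M (indicat_real ?A)" "integrable M (indicat_real ?B)"
      by (auto simp: emeasure_eq_measure)
    then show ?thesis by (subst Bochner_Integration.integral_add) auto
  qed
  also have "\<dots> = (g (- v) + v * g 1) / (1 + v)"
    using assms by (simp add: bernoulli_rv_def add_divide_distrib mult.commute)
  finally show ?thesis .
qed

lemma bernoulli_rv_moments:
  assumes "bernoulli_rv M v e" "v > 0"
  shows "expectation e = 0" "variance e = v" "skewness M e = (1 - v) / sqrt v"
proof -
  have nz: "1 + v \<noteq> 0" using assms by simp
  show 1: "expectation e = 0" using expectation_bernoulli_rv[OF assms, of "\<lambda>x. x"] by simp
  have "expectation (\<lambda>\<omega>. (e \<omega>)\<^sup>2) = (v\<^sup>2 + v) / (1 + v)"
    using expectation_bernoulli_rv[OF assms, of "\<lambda>x. x\<^sup>2"] by simp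
  also have "\<dots> = v" using nz by (simp add: field_simps power2_eq_square)
  finally show 2: "variance e = v" by (simp add: 1)
  have "expectation (\<lambda>\<omega>. e \<omega> ^ 3) = (v - v ^ 3) / (1 + v)"
    using expectation_bernoulli_rv[OF assms, of "\<lambda>x. x ^ 3"] by simp
  also have "\<dots> = v * (1 - v)" using nz by (simp add: field_simps power3_eq_cube)
  finally have "skewness M e = v * (1 - v) / (v * sqrt v)"
    using assms(2) unfolding skewness_def 2 by (simp add: power3_eq_cube)
  then show "skewness M e = (1 - v) / sqrt v" using assms(2) by simp
qed

text \<open>Splitting with the indicators of the two atoms of \<open>e\<close> leaves only
  translates of \<open>Y\<close> inside \<open>g\<close>, and independence factors each term. This
  is the probabilistic counterpart of one application of \<open>bern\<close>.\<close>

lemma expectation_add_bernoulli_rv: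
  assumes e: "bernoulli_rv M v e" "v > 0" and indep: "indep_var borel e borel Y"
    and [measurable]: "g \<in> borel_measurable borel" and g: "\<And>a. integrable M (\<lambda>\<omega>. g (Y \<omega> + a))"
  shows "expectation (\<lambda>\<omega>. g (Y \<omega> + e \<omega>) :: real) =
    (expectation (\<lambda>\<omega>. g (Y \<omega> - v)) + v * expectation (\<lambda>\<omega>. g (Y \<omega> + 1))) / (1 + v)"
proof -
  have [measurable]: "e \<in> borel_measurable M" "Y \<in> borel_measurable M"
    using indep by (auto dest: indep_var_rv1 indep_var_rv2)
  let ?A = "\<lambda>\<omega>. indicator {- v} (e \<omega>) :: real" and ?B = "\<lambda>\<omega>. indicator {1} (e \<omega>) :: real"
  have g': "integrable M (\<lambda>\<omega>. g (Y \<omega> - v))" using g[of "- v"] by simp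
  have *: "integrable M (\<lambda>\<omega>. indicator {a} (e \<omega>) * g (Y \<omega> + b))"
    "expectation (\<lambda>\<omega>. indicator {a} (e \<omega>) * g (Y \<omega> + b)) =
      expectation (\<lambda>\<omega>. indicator {a} (e \<omega>)) * expectation (\<lambda>\<omega>. g (Y \<omega> + b))" for a b
  proof -
    have "indep_var borel (indicator {a} \<circ> e) borel ((\<lambda>y. g (y + b)) \<circ> Y)"
      by (rule indep_var_compose[OF indep]) auto
    then have i: "indep_var borel (\<lambda>\<omega>. indicator {a} (e \<omega>) :: real) borel (\<lambda>\<omega>. g (Y \<omega> + b))"
      by (simp add: o_def)
    have int: "integrable M (\<lambda>\<omega>. indicator {a} (e \<omega>) :: real)"
      by (rule integrable_const_bound[where B=1]) (auto simp: indicator_def)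
    show "integrable M (\<lambda>\<omega>. indicator {a} (e \<omega>) * g (Y \<omega> + b))"
      by (rule indep_var_integrable[OF i int g])
    show "expectation (\<lambda>\<omega>. indicator {a} (e \<omega>) * g (Y \<omega> + b)) =
      expectation (\<lambda>\<omega>. indicator {a} (e \<omega>)) * expectation (\<lambda>\<omega>. g (Y \<omega> + b))"
      by (rule indep_var_lebesgue_integral[OF i int g])
  qed
  have "expectation (\<lambda>\<omega>. g (Y \<omega> + e \<omega>)) = expectation (\<lambda>\<omega>. ?A \<omega> * g (Y \<omega> + (- v)) + ?B \<omega> * g (Y \<omega> + 1))"
    using AE_bernoulli_rv[OF e] e(2)
    by (intro integral_cong_AE) (auto simp: indicator_def elim!: eventually_mono)
  also have "\<dots> = expectation ?A * expectation (\<lambda>\<omega>. g (Y \<omega> - v)) + expectation ?B * expectation (\<lambda>\<omega>. g (Y \<omega> + 1))"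
    using *[of "- v" "- v"] *[of 1 1] by (subst Bochner_Integration.integral_add) simp_all
  also have "expectation ?A = 1 / (1 + v)"
    using expectation_bernoulli_rv[OF e, of "indicator {- v}"] e(2) by simp
  also have "expectation ?B = v / (1 + v)"
    using expectation_bernoulli_rv[OF e, of "indicator {1}"] e(2) by simp
  finally show ?thesis by (simp add: add_divide_distrib)
qed

lemma AE_sum_bernoulli_rv_le:
  assumes "\<And>k. k \<in> {1..n} \<Longrightarrow> bernoulli_rv M v (e k)" "v > 0"
  shows "AE \<omega> in M. (\<Sum>k=1..n. e k \<omega>) \<le> real n"
proof -
  have "AE \<omega> in M. \<forall>k\<in>{1..n}. e k \<omega> = - v \<or> e k \<omega> = 1"
    using assms by (intro AE_finite_allI AE_bernoulli_rv) auto
  then show ?thesis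
  proof eventually_elim
    case (elim \<omega>)
    have "(\<Sum>k=1..n. e k \<omega>) \<le> (\<Sum>k=1..n. 1)"
      using elim assms(2) by (force intro!: sum_mono)
    then show ?case by simp
  qed
qed

lemma integrable_max_square:
  assumes [measurable]: "Y \<in> borel_measurable M" and "AE \<omega> in M. Y \<omega> \<le> (C :: real)"
  shows "integrable M (\<lambda>\<omega>. (max 0 (Y \<omega> - h))\<^sup>2)"
proof (rule integrable_const_bound[where B="(max 0 (C - h))\<^sup>2"])
  show "AE \<omega> in M. norm ((max 0 (Y \<omega> - h))\<^sup>2) \<le> (max 0 (C - h))\<^sup>2"
    using assms(2) by eventually_elim (auto intro!: power_mono)
qed measurable

lemma expectation_max_square_sum_bernoulli_rv:
  assumes "\<And>k. k \<in> {1..n} \<Longrightarrow> bernoulli_rv M v (e k)" "v > 0" "indep_vars (\<lambda>_. borel) e {1..n}"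
  shows "expectation (\<lambda>\<omega>. (max 0 ((\<Sum>k=1..n. e k \<omega>) - h))\<^sup>2) = fold_mset bern pos_sq (replicate_mset n v) h"
  using assms
proof (induction n arbitrary: h)
  case 0
  then show ?case by (simp add: pos_sq_def prob_space)
next
  case (Suc n)
  let ?T = "\<lambda>\<omega>. \<Sum>k=1..n. e k \<omega>" and ?g = "\<lambda>y. (max 0 (y - h))\<^sup>2 :: real"
  have e: "bernoulli_rv M v (e k)" if "k \<in> {1..n}" for k using Suc.prems(1)[of k] that by simp
  have i: "indep_vars (\<lambda>_. borel) e {1..n}"
    using Suc.prems(3) by (rule indep_vars_subset) auto
  have "indep_vars (\<lambda>_. borel) e (insert (Suc n) {1..n})"
    using Suc.prems(3) by (simp add: atLeastAtMostSuc_conv)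
  then have ind: "indep_var borel (e (Suc n)) borel ?T"
    by (intro indep_vars_sum) auto
  then have [measurable]: "?T \<in> borel_measurable M" by (rule indep_var_rv2)
  have int: "integrable M (\<lambda>\<omega>. ?g (?T \<omega> + a))" for a
  proof -
    have "AE \<omega> in M. ?T \<omega> \<le> real n"
      using e Suc.prems(2) by (intro AE_sum_bernoulli_rv_le) auto
    then have "integrable M (\<lambda>\<omega>. (max 0 (?T \<omega> - (h - a)))\<^sup>2)"
      by (intro integrable_max_square) measurable
    also have "(\<lambda>\<omega>. (max 0 (?T \<omega> - (h - a)))\<^sup>2) = (\<lambda>\<omega>. ?g (?T \<omega> + a))"
      by (simp add: algebra_simps)
    finally show ?thesis .
  qed
  have "expectation (\<lambda>\<omega>. ?g (?T \<omega> + e (Suc n) \<omega>)) =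
     (expectation (\<lambda>\<omega>. ?g (?T \<omega> - v)) + v * expectation (\<lambda>\<omega>. ?g (?T \<omega> + 1))) / (1 + v)"
    using Suc.prems by (intro expectation_add_bernoulli_rv ind int) auto
  \<comment> \<open>Translating the partial sum by -v or 1 is the same as moving \<open>h\<close> to
    h+v or h-1, the two arguments at which \<open>bern\<close> evaluates.\<close>
  also have "(\<lambda>\<omega>. ?g (?T \<omega> - v)) = (\<lambda>\<omega>. (max 0 (?T \<omega> - (h + v)))\<^sup>2)"
    by (simp add: algebra_simps)
  also have "(\<lambda>\<omega>. ?g (?T \<omega> + 1)) = (\<lambda>\<omega>. (max 0 (?T \<omega> - (h - 1)))\<^sup>2)"
    by (simp add: algebra_simps)
  finally show ?case
    using Suc.IH[OF _ Suc.prems(2) i] e by (simp add: bern_def[of v])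
qed

end

text \<open>The substitution r = t - s turns the integrand into e^(lt) times the density l^3 r^2
  e^(-lr) / 2 on r >= 0. This is the Erlang density with library parameter 2 and rate
  \<open>l\<close>; its total mass 1 fixes the constant l^3/2.\<close>

lemma nn_integral_exp_eq_mixture:
  assumes "l > (0::real)"
  shows "(\<integral>\<^sup>+ s. ennreal (l ^ 3 / 2 * exp (l * s) * (max 0 (t - s))\<^sup>2) \<partial>lborel) = ennreal (exp (l * t))"
proof -
  have "(\<integral>\<^sup>+ s. ennreal (l ^ 3 / 2 * exp (l * s) * (max 0 (t - s))\<^sup>2) \<partial>lborel) =
      (\<integral>\<^sup>+ r. ennreal (l ^ 3 / 2 * exp (l * (t - r)) * (max 0 r)\<^sup>2) \<partial>lborel)"
    by (subst nn_integral_real_affine[where c="-1" and t=t]) auto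
  also have "\<dots> = (\<integral>\<^sup>+ r. ennreal (exp (l * t)) * ennreal (erlang_density 2 l r * r ^ 0) \<partial>lborel)"
    by (intro nn_integral_cong)
       (auto simp: erlang_density_def ennreal_mult[symmetric] max_def right_diff_distrib exp_diff
         exp_minus field_simps numeral_2_eq_2 numeral_3_eq_3 assms less_imp_le)
  also have "\<dots> = ennreal (exp (l * t)) * (\<integral>\<^sup>+ r. ennreal (erlang_density 2 l r * r ^ 0) \<partial>lborel)"
    by (rule nn_integral_cmult) auto
  also have "\<dots> = ennreal (exp (l * t))"
    using assms by (subst nn_integral_erlang_ith_moment) auto
  finally show ?thesis .
qed

text \<open>The quadratic bounds are integrated over all \<open>h\<close> against the weight of the
  preceding mixture, and the order of integration is exchanged. For h >= x the left side of the
  bound is replaced by 0, so bounds for h < x suffice. The upper bound on \<open>T\<close> makes the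
  expectations genuine integrals.\<close>

lemma (in prob_space) exp_bound_of_max_square_bound:
  assumes [measurable]: "T \<in> borel_measurable M" and Tb: "AE \<omega> in M. T \<omega> \<le> (b :: real)"
    and l: "l > (0 :: real)" and p: "p \<ge> 0"
    and le: "\<And>h. h < x \<Longrightarrow> p * (x - h)\<^sup>2 \<le> expectation (\<lambda>\<omega>. (max 0 (T \<omega> - h))\<^sup>2)"
  shows "p \<le> exp (- l * x) * expectation (\<lambda>\<omega>. exp (l * T \<omega>))"
proof -
  interpret pair_sigma_finite lborel M ..
  have int: "integrable M (\<lambda>\<omega>. exp (l * T \<omega>))"
  proof (rule integrable_const_bound[where B="exp (l * b)"])
    show "AE \<omega> in M. norm (exp (l * T \<omega>)) \<le> exp (l * b)"
      using Tb by eventually_elim (use l in simp)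
  qed measurable
  have "ennreal (p * exp (l * x)) = ennreal p * (\<integral>\<^sup>+ s. ennreal (l ^ 3 / 2 * exp (l * s) * (max 0 (x - s))\<^sup>2) \<partial>lborel)"
    by (simp only: nn_integral_exp_eq_mixture[OF l] ennreal_mult[OF p] exp_ge_zero)
  also have "\<dots> = (\<integral>\<^sup>+ s. ennreal (l ^ 3 / 2 * exp (l * s) * (p * (max 0 (x - s))\<^sup>2)) \<partial>lborel)"
    using p l by (subst nn_integral_cmult[symmetric]) (auto simp: ennreal_mult[symmetric] mult_ac)
  also have "\<dots> \<le> (\<integral>\<^sup>+ s. ennreal (l ^ 3 / 2 * exp (l * s) * expectation (\<lambda>\<omega>. (max 0 (T \<omega> - s))\<^sup>2)) \<partial>lborel)"
  proof (intro nn_integral_mono ennreal_leI mult_left_mono)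
    fix s show "p * (max 0 (x - s))\<^sup>2 \<le> expectation (\<lambda>\<omega>. (max 0 (T \<omega> - s))\<^sup>2)"
      using le[of s] by (cases "s < x") (auto simp: max_def)
  qed (use l in auto)
  also have "\<dots> = (\<integral>\<^sup>+ s. \<integral>\<^sup>+ \<omega>. ennreal (l ^ 3 / 2 * exp (l * s) * (max 0 (T \<omega> - s))\<^sup>2) \<partial>M \<partial>lborel)"
  proof (intro nn_integral_cong)
    fix s :: real
    have "(\<integral>\<^sup>+ \<omega>. ennreal (l ^ 3 / 2 * exp (l * s) * (max 0 (T \<omega> - s))\<^sup>2) \<partial>M) =
        ennreal (expectation (\<lambda>\<omega>. l ^ 3 / 2 * exp (l * s) * (max 0 (T \<omega> - s))\<^sup>2))"
      using l integrable_max_square[OF _ Tb, of s] by (intro nn_integral_eq_integral) auto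
    then show "ennreal (l ^ 3 / 2 * exp (l * s) * expectation (\<lambda>\<omega>. (max 0 (T \<omega> - s))\<^sup>2)) =
      (\<integral>\<^sup>+ \<omega>. ennreal (l ^ 3 / 2 * exp (l * s) * (max 0 (T \<omega> - s))\<^sup>2) \<partial>M)" by simp
  qed
  also have "\<dots> = (\<integral>\<^sup>+ \<omega>. \<integral>\<^sup>+ s. ennreal (l ^ 3 / 2 * exp (l * s) * (max 0 (T \<omega> - s))\<^sup>2) \<partial>lborel \<partial>M)"
    by (rule Fubini'[symmetric]) measurable
  also have "\<dots> = ennreal (expectation (\<lambda>\<omega>. exp (l * T \<omega>)))"
    unfolding nn_integral_exp_eq_mixture[OF l] using int by (intro nn_integral_eq_integral) auto
  finally have "p * exp (l * x) \<le> expectation (\<lambda>\<omega>. exp (l * T \<omega>))"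
    by (subst (asm) ennreal_le_iff) (auto intro: Bochner_Integration.integral_nonneg)
  then show ?thesis by (simp add: exp_minus field_simps)
qed

section \<open>Conditional variance and skewness\<close>

lemma u_pos: "u c > 0"
proof -
  have "\<bar>c / 2\<bar> < sqrt (1 + c\<^sup>2 / 4)"
    by (rule real_less_rsqrt) (simp add: power_divide)
  then show ?thesis by (simp add: u_def abs_less_iff)
qed

lemma u_root: "(u c)\<^sup>2 + c * u c = 1"
proof -
  have "(sqrt (1 + c\<^sup>2 / 4))\<^sup>2 = 1 + c\<^sup>2 / 4" by (simp add: add_nonneg_nonneg)
  then show ?thesis by (simp add: u_def power2_diff field_simps power2_eq_square)
qed

text \<open>By \<open>u_root\<close>, \<open>u c\<close> is a root of s^2 + cs - 1, which therefore
  factors as (s - u(c))(s + u(c) + c). The second factor is positive because u(c) + c =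
  1/u(c).\<close>

lemma gt_u:
  assumes "u c < s" shows "s\<^sup>2 + c * s > 1"
proof -
  have "0 < (s - u c) * (u c + c + s)"
  proof (rule mult_pos_pos)
    have "u c * (u c + c) = 1" using u_root[of c] by (simp add: power2_eq_square algebra_simps)
    then have "u c + c > 0" using u_pos[of c] by (metis zero_less_mult_pos zero_less_one)
    then show "u c + c + s > 0" using u_pos[of c] assms by simp
  qed (use assms in simp)
  then show ?thesis using u_root[of c] by (simp add: power2_eq_square algebra_simps)
qed

section \<open>Conditional moments of variables with possibly infinite second or third
  moment\<close>

context finite_measure_subalgebra begin

lemma integrable_mult_bounded:
  fixes f :: "'a \<Rightarrow> real"
  assumes f: "integrable M f" and [measurable]: "a \<in> borel_measurable F" and a: "\<And>\<omega>. \<omega> \<in> space M \<Longrightarrow> \<bar>a \<omega>\<bar> \<le> K"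
  shows "integrable M (\<lambda>\<omega>. a \<omega> * f \<omega>)"
proof (rule Bochner_Integration.integrable_bound)
  show "integrable M (\<lambda>\<omega>. K * f \<omega>)" using f by simp
  have [measurable]: "f \<in> borel_measurable M" using f by simp
  have [measurable]: "a \<in> borel_measurable M" using subalg assms(2) by (rule measurable_from_subalg)
  show "(\<lambda>\<omega>. a \<omega> * f \<omega>) \<in> borel_measurable M" by measurable
  show "AE \<omega> in M. norm (a \<omega> * f \<omega>) \<le> norm (K * f \<omega>)"
  proof (rule AE_I2)
    fix \<omega> assume "\<omega> \<in> space M"
    then have "\<bar>a \<omega>\<bar> \<le> \<bar>K\<bar>" using a[of \<omega>] by linarith
    then show "norm (a \<omega> * f \<omega>) \<le> norm (K * f \<omega>)" by (simp add: abs_mult mult_right_mono)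
  qed
qed

text \<open>Here \<open>f\<close> itself may fail to be integrable. The conditional expectation of
  |f| is the sum of those of its positive and negative parts, and an \<open>F\<close>-measurable
  weight can be pulled in, so the integral of |a f| is at most \<open>K\<close> times the total
  mass. It is applied to the square and the cube of a martingale difference.\<close>

lemma integrable_mult_of_nn_cond_exp_le:
  fixes f :: "'a \<Rightarrow> real"
  assumes [measurable]: "f \<in> borel_measurable M" "a \<in> borel_measurable F"
    and le: "AE \<omega> in M. ennreal \<bar>a \<omega>\<bar> *
      (nn_cond_exp M F (\<lambda>\<omega>. ennreal (f \<omega>)) \<omega> + nn_cond_exp M F (\<lambda>\<omega>. ennreal (- f \<omega>)) \<omega>) \<le> ennreal K"
  shows "integrable M (\<lambda>\<omega>. a \<omega> * f \<omega>)"
proof (rule integrableI_bounded)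
  have [measurable]: "a \<in> borel_measurable M" using subalg assms(2) by (rule measurable_from_subalg)
  show "(\<lambda>\<omega>. a \<omega> * f \<omega>) \<in> borel_measurable M" by measurable
  let ?P = "nn_cond_exp M F (\<lambda>\<omega>. ennreal (f \<omega>))" and ?N = "nn_cond_exp M F (\<lambda>\<omega>. ennreal (- f \<omega>))"
  have "(\<integral>\<^sup>+ \<omega>. ennreal (norm (a \<omega> * f \<omega>)) \<partial>M) =
      (\<integral>\<^sup>+ \<omega>. ennreal \<bar>a \<omega>\<bar> * ennreal (f \<omega>) + ennreal \<bar>a \<omega>\<bar> * ennreal (- f \<omega>) \<partial>M)"
  proof (intro nn_integral_cong)
    fix \<omega>
    have "ennreal \<bar>f \<omega>\<bar> = ennreal (f \<omega>) + ennreal (- f \<omega>)"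
      by (auto simp: abs_real_def ennreal_neg)
    then show "ennreal (norm (a \<omega> * f \<omega>)) = ennreal \<bar>a \<omega>\<bar> * ennreal (f \<omega>) + ennreal \<bar>a \<omega>\<bar> * ennreal (- f \<omega>)"
      by (simp add: abs_mult ennreal_mult distrib_left)
  qed
  also have "\<dots> = (\<integral>\<^sup>+ \<omega>. ennreal \<bar>a \<omega>\<bar> * ennreal (f \<omega>) \<partial>M) + (\<integral>\<^sup>+ \<omega>. ennreal \<bar>a \<omega>\<bar> * ennreal (- f \<omega>) \<partial>M)"
    by (rule nn_integral_add) measurable
  also have "\<dots> = (\<integral>\<^sup>+ \<omega>. ennreal \<bar>a \<omega>\<bar> * ?P \<omega> \<partial>M) + (\<integral>\<^sup>+ \<omega>. ennreal \<bar>a \<omega>\<bar> * ?N \<omega> \<partial>M)"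
    by (subst (1 2) nn_cond_exp_intg) measurable
  also have "\<dots> = (\<integral>\<^sup>+ \<omega>. ennreal \<bar>a \<omega>\<bar> * (?P \<omega> + ?N \<omega>) \<partial>M)"
    by (subst nn_integral_add[symmetric]) (auto simp: distrib_left)
  also have "\<dots> \<le> (\<integral>\<^sup>+ \<omega>. ennreal K \<partial>M)"
    by (rule nn_integral_mono_AE[OF le])
  also have "\<dots> < \<infinity>"
    by (simp add: emeasure_eq_measure ennreal_mult[symmetric] ennreal_mult_less_top)
  finally show "(\<integral>\<^sup>+ \<omega>. ennreal (norm (a \<omega> * f \<omega>)) \<partial>M) < \<infinity>" .
qed

lemma nn_cond_exp_neg_square:
  fixes X :: "'a \<Rightarrow> real"
  shows "AE \<omega> in M. nn_cond_exp M F (\<lambda>\<omega>. ennreal (- ((X \<omega>)\<^sup>2))) \<omega> = 0"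
proof -
  have "(\<lambda>\<omega>. ennreal (- ((X \<omega>)\<^sup>2))) = (\<lambda>_. 0)" by (simp add: ennreal_neg)
  then show ?thesis using nn_cond_exp_F_meas[of "\<lambda>_. 0"] by auto
qed

text \<open>The negative part contributes nothing. Where the conditional variance is infinite, both
  sides take the default value 0.\<close>

lemma real_cond_exp_square:
  fixes X :: "'a \<Rightarrow> real"
  shows "AE \<omega> in M. real_cond_exp M F (\<lambda>\<omega>. (X \<omega>)\<^sup>2) \<omega> = enn2real (cond_var M F X \<omega>)"
  using nn_cond_exp_neg_square[of X]
  by eventually_elim (simp add: real_cond_exp_def cond_var_def)

text \<open>Since the square and the cube of \<open>X\<close> need not be integrable, conditional
  expectations of the cubic polynomial are not taken directly. Instead the polynomial is integrated
  over \<open>F\<close>-measurable sets where the bound fails but the conditional moments stay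
  bounded; each such set is shown to be null.\<close>

lemma cond_var_le_u_square:
  fixes X :: "'a \<Rightarrow> real"
  assumes X: "integrable M X" and X1: "AE \<omega> in M. X \<omega> \<le> 1" and X0: "AE \<omega> in M. real_cond_exp M F X \<omega> = 0"
    and fin: "AE \<omega> in M. cond_var M F X \<omega> < \<infinity>"
    and skew: "AE \<omega> in M. ereal c \<le> cond_skewness M F X \<omega>"
  shows "AE \<omega> in M. cond_var M F X \<omega> \<le> ennreal ((u c)\<^sup>2)"
proof -
  have [measurable]: "X \<in> borel_measurable M" using X by simp
  define V where "V \<omega> = enn2real (cond_var M F X \<omega>)" for \<omega>
  define P where "P = nn_cond_exp M F (\<lambda>\<omega>. ennreal (X \<omega> ^ 3))"
  define N where "N = nn_cond_exp M F (\<lambda>\<omega>. ennreal (- (X \<omega> ^ 3)))"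
  define E3 where "E3 = real_cond_exp M F (\<lambda>\<omega>. X \<omega> ^ 3)"
  have [measurable]: "P \<in> borel_measurable F" "N \<in> borel_measurable F" "V \<in> borel_measurable F"
    by (auto simp: P_def N_def V_def[abs_def] cond_var_def)
  have [measurable]: "E3 \<in> borel_measurable M" by (simp add: E3_def)
  have sp: "space F = space M" using subalg by (simp add: subalgebra_def)
  have V0: "V \<omega> \<ge> 0" for \<omega> by (simp add: V_def)
  have "AE \<omega> in M. P \<omega> \<le> nn_cond_exp M F (\<lambda>_. 1) \<omega>"
    unfolding P_def using X1
    by (intro nn_cond_exp_mono) (auto elim!: eventually_mono dest: power_mono_odd[of 3 _ "1 :: real", simplified])
  then have P1: "AE \<omega> in M. P \<omega> \<le> 1"
    using nn_cond_exp_F_meas[of "\<lambda>_. 1", OF borel_measurable_const] by eventually_elim auto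
  \<comment> \<open>Where V > 0 the skewness is an actual quotient. As P <= 1, an infinite
    \<open>N\<close> would make it minus infinity, contradicting the real lower bound
    \<open>c\<close>; hence the extended inequality is one between real numbers. Where V = 0 nothing
    is claimed, in line with the convention that the skewness is then infinite.\<close>
  have key: "AE \<omega> in M. 0 < V \<omega> \<longrightarrow> N \<omega> < \<infinity> \<and> c * (V \<omega> * sqrt (V \<omega>)) \<le> E3 \<omega>"
    using skew P1
  proof eventually_elim
    case (elim \<omega>)
    show ?case
    proof
      assume V: "0 < V \<omega>"
      have s3: "sqrt (V \<omega>) ^ 3 = V \<omega> * sqrt (V \<omega>)" using V by (simp add: power3_eq_cube)
      have c: "ereal c \<le> (enn2ereal (P \<omega>) - enn2ereal (N \<omega>)) / ereal (V \<omega> * sqrt (V \<omega>))"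
        using elim(1) V by (simp add: cond_skewness_def cond_sd_def ereal_cond_exp_def P_def N_def V_def[symmetric] s3)
      obtain p where p: "P \<omega> = ennreal p" "p \<ge> 0" using elim(2) by (cases "P \<omega>") (auto simp: top_unique)
      have pos: "0 < V \<omega> * sqrt (V \<omega>)" using V by simp
      obtain q where q: "N \<omega> = ennreal q" "q \<ge> 0"
        using c p pos by (cases "N \<omega>") (auto simp: enn2ereal_ennreal)
      have "ereal c \<le> ereal ((p - q) / (V \<omega> * sqrt (V \<omega>)))"
        using c p q pos V by (simp add: enn2ereal_ennreal)
      then have "c * (V \<omega> * sqrt (V \<omega>)) \<le> p - q"
        using pos by (simp add: pos_le_divide_eq)
      moreover have "E3 \<omega> = p - q"
        using p q by (simp add: E3_def real_cond_exp_def P_def[symmetric] N_def[symmetric])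
      ultimately show "N \<omega> < \<infinity> \<and> c * (V \<omega> * sqrt (V \<omega>)) \<le> E3 \<omega>"
        using q by simp
    qed
  qed
  have "AE \<omega> in M. \<not> ((u c)\<^sup>2 < V \<omega> \<and> V \<omega> \<le> real m \<and> N \<omega> \<le> ennreal (real m))" for m
  proof -
    define A where "A = {\<omega> \<in> space F. (u c)\<^sup>2 < V \<omega> \<and> V \<omega> \<le> real m \<and> N \<omega> \<le> ennreal (real m)}"
    have [measurable]: "A \<in> sets F" unfolding A_def by measurable
    \<comment> \<open>The coefficients, cut off outside \<open>A\<close>, of (1-x)(x+V)^2 = V^2 +
      (2V - V^2) x + (1 - 2V) x^2 - x^3. The truncation at \<open>m\<close> makes every product with
      a power of \<open>X\<close> integrable.\<close>
    define a0 where "a0 \<omega> = indicator A \<omega> * (V \<omega>)\<^sup>2" for \<omega>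
    define a1 where "a1 \<omega> = indicator A \<omega> * (2 * V \<omega> - (V \<omega>)\<^sup>2)" for \<omega>
    define a2 where "a2 \<omega> = indicator A \<omega> * (1 - 2 * V \<omega>)" for \<omega>
    define a3 where "a3 \<omega> = (indicator A \<omega> :: real)" for \<omega>
    have [measurable]: "a0 \<in> borel_measurable F" "a1 \<in> borel_measurable F" "a2 \<in> borel_measurable F" "a3 \<in> borel_measurable F"
      unfolding a0_def[abs_def] a1_def[abs_def] a2_def[abs_def] a3_def[abs_def] by measurable
    have bd: "\<bar>a0 \<omega>\<bar> \<le> (real m)\<^sup>2" "\<bar>a1 \<omega>\<bar> \<le> 2 * real m + (real m)\<^sup>2" "\<bar>a2 \<omega>\<bar> \<le> 1 + 2 * real m" for \<omega>
    proof -
      have V2: "(V \<omega>)\<^sup>2 \<le> (real m)\<^sup>2" "V \<omega> \<le> real m" if "\<omega> \<in> A"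
        using that V0[of \<omega>] by (auto simp: A_def intro: power_mono)
      show "\<bar>a0 \<omega>\<bar> \<le> (real m)\<^sup>2" using V2 by (simp add: a0_def indicator_def)
      have "\<bar>2 * V \<omega> - (V \<omega>)\<^sup>2\<bar> \<le> 2 * V \<omega> + (V \<omega>)\<^sup>2"
        using V0[of \<omega>] zero_le_power2[of "V \<omega>"] by linarith
      then have "\<bar>2 * V \<omega> - (V \<omega>)\<^sup>2\<bar> \<le> 2 * real m + (real m)\<^sup>2" if "\<omega> \<in> A"
        using V2[OF that] by linarith
      then show "\<bar>a1 \<omega>\<bar> \<le> 2 * real m + (real m)\<^sup>2"
        by (cases "\<omega> \<in> A") (simp_all add: a1_def)
      have "\<bar>1 - 2 * V \<omega>\<bar> \<le> 1 + 2 * V \<omega>" using V0[of \<omega>] by linarith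
      then show "\<bar>a2 \<omega>\<bar> \<le> 1 + 2 * real m"
        using V2 by (cases "\<omega> \<in> A") (auto simp: a2_def)
    qed
    have i0: "integrable M (\<lambda>\<omega>. a0 \<omega> * 1)"
      using bd(1) by (intro integrable_mult_bounded) auto
    have i1: "integrable M (\<lambda>\<omega>. a1 \<omega> * X \<omega>)"
      using bd(2) by (intro integrable_mult_bounded X) auto
    have i2: "integrable M (\<lambda>\<omega>. a2 \<omega> * (X \<omega>)\<^sup>2)"
    proof (rule integrable_mult_of_nn_cond_exp_le)
      show "AE \<omega> in M. ennreal \<bar>a2 \<omega>\<bar> *
        (nn_cond_exp M F (\<lambda>\<omega>. ennreal ((X \<omega>)\<^sup>2)) \<omega> + nn_cond_exp M F (\<lambda>\<omega>. ennreal (- (X \<omega>)\<^sup>2)) \<omega>) \<le> ennreal ((1 + 2 * real m) * real m)"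
        using fin nn_cond_exp_neg_square[of X]
      proof eventually_elim
        case (elim \<omega>)
        show ?case
        proof (cases "\<omega> \<in> A")
          case True
          have "nn_cond_exp M F (\<lambda>\<omega>. ennreal ((X \<omega>)\<^sup>2)) \<omega> = ennreal (V \<omega>)"
            using elim(1) by (simp add: V_def cond_var_def less_top[symmetric])
          also have "\<dots> \<le> ennreal (real m)" using True by (intro ennreal_leI) (auto simp: A_def)
          finally have "nn_cond_exp M F (\<lambda>\<omega>. ennreal ((X \<omega>)\<^sup>2)) \<omega> \<le> ennreal (real m)" .
          moreover have "ennreal \<bar>a2 \<omega>\<bar> \<le> ennreal (1 + 2 * real m)"
            using bd(3) by (rule ennreal_leI)
          ultimately show ?thesis using elim(2)
            by (subst ennreal_mult) (auto simp del: ennreal_plus intro!: mult_mono)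
        qed (simp add: a2_def)
      qed
    qed measurable
    have i3: "integrable M (\<lambda>\<omega>. a3 \<omega> * X \<omega> ^ 3)"
    proof (rule integrable_mult_of_nn_cond_exp_le)
      show "AE \<omega> in M. ennreal \<bar>a3 \<omega>\<bar> *
        (nn_cond_exp M F (\<lambda>\<omega>. ennreal (X \<omega> ^ 3)) \<omega> + nn_cond_exp M F (\<lambda>\<omega>. ennreal (- (X \<omega> ^ 3))) \<omega>) \<le> ennreal (1 + real m)"
        using P1
      proof eventually_elim
        case (elim \<omega>)
        then have "P \<omega> + N \<omega> \<le> ennreal 1 + ennreal (real m)" if "\<omega> \<in> A"
          using that by (intro add_mono) (auto simp: A_def)
        then show ?case by (auto simp: a3_def indicator_def P_def N_def)
      qed
    qed measurable
    \<comment> \<open>\<open>?g\<close> arises from \<open>?f\<close> by replacing each power of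
      \<open>X\<close> with its conditional expectation; as the coefficients are
      \<open>F\<close>-measurable, the integrals agree.\<close>
    let ?f = "\<lambda>\<omega>. a0 \<omega> * 1 + a1 \<omega> * X \<omega> + a2 \<omega> * (X \<omega>)\<^sup>2 - a3 \<omega> * X \<omega> ^ 3"
    let ?g = "\<lambda>\<omega>. a0 \<omega> * 1 + a1 \<omega> * real_cond_exp M F X \<omega> + a2 \<omega> * real_cond_exp M F (\<lambda>\<omega>. (X \<omega>)\<^sup>2) \<omega> - a3 \<omega> * E3 \<omega>"
    have j1: "integrable M (\<lambda>\<omega>. a1 \<omega> * real_cond_exp M F X \<omega>)"
      "(\<integral>\<omega>. a1 \<omega> * real_cond_exp M F X \<omega> \<partial>M) = (\<integral>\<omega>. a1 \<omega> * X \<omega> \<partial>M)"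
      using i1 by (auto intro: real_cond_exp_intg)
    have j2: "integrable M (\<lambda>\<omega>. a2 \<omega> * real_cond_exp M F (\<lambda>\<omega>. (X \<omega>)\<^sup>2) \<omega>)"
      "(\<integral>\<omega>. a2 \<omega> * real_cond_exp M F (\<lambda>\<omega>. (X \<omega>)\<^sup>2) \<omega> \<partial>M) = (\<integral>\<omega>. a2 \<omega> * (X \<omega>)\<^sup>2 \<partial>M)"
      using i2 by (auto intro: real_cond_exp_intg)
    have j3: "integrable M (\<lambda>\<omega>. a3 \<omega> * E3 \<omega>)"
      "(\<integral>\<omega>. a3 \<omega> * E3 \<omega> \<partial>M) = (\<integral>\<omega>. a3 \<omega> * X \<omega> ^ 3 \<partial>M)"
      unfolding E3_def using i3 by (auto intro: real_cond_exp_intg)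
    have "0 \<le> (\<integral>\<omega>. ?f \<omega> \<partial>M)"
    proof (rule integral_nonneg_AE)
      show "AE \<omega> in M. 0 \<le> ?f \<omega>" using X1
      proof eventually_elim
        case (elim \<omega>)
        have "?f \<omega> = indicator A \<omega> * ((1 - X \<omega>) * (X \<omega> + V \<omega>)\<^sup>2)"
          by (simp add: a0_def a1_def a2_def a3_def algebra_simps power2_eq_square power3_eq_cube)
        then show ?case using elim by simp
      qed
    qed
    also have "(\<integral>\<omega>. ?f \<omega> \<partial>M) = (\<integral>\<omega>. ?g \<omega> \<partial>M)"
      using i0 i1 i2 i3 j1 j2 j3 by simp
    finally have "(\<integral>\<omega>. - ?g \<omega> \<partial>M) \<le> 0"
      by (simp only: Bochner_Integration.integral_minus neg_le_0_iff_le)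
    \<comment> \<open>On \<open>A\<close>, with s^2 = V, the integrand \<open>?g\<close> equals s^2
      - s^4 - E3, so -\<open>?g\<close> >= s^2 (s^2 + cs - 1) > 0 by \<open>gt_u\<close>. Off
      \<open>A\<close> it vanishes. A nonnegative function with nonpositive integral is zero almost
      everywhere, so \<open>A\<close> is null.\<close>
    moreover have sgn: "AE \<omega> in M. 0 \<le> - ?g \<omega> \<and> (- ?g \<omega> = 0 \<longrightarrow> \<omega> \<notin> A)"
      using X0 real_cond_exp_square[of X] key
    proof eventually_elim
      case (elim \<omega>)
      have "0 < - ?g \<omega>" if "\<omega> \<in> A"
      proof -
        define s where "s = sqrt (V \<omega>)"
        have Vs: "V \<omega> = s\<^sup>2" using V0[of \<omega>] by (simp add: s_def)
        have us: "u c < s" using that u_pos[of c] unfolding s_def A_def by (intro real_less_rsqrt) auto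
        then have "0 < s\<^sup>2 * (s\<^sup>2 + c * s - 1)"
          using gt_u[OF us] u_pos[of c] by (intro mult_pos_pos) auto
        moreover have "c * (s\<^sup>2 * s) \<le> E3 \<omega>"
          using elim(3) us u_pos[of c] Vs by (simp add: s_def[symmetric])
        moreover have "?g \<omega> = s\<^sup>2 - s ^ 4 - E3 \<omega>"
          using that elim(1,2) unfolding V_def[symmetric] Vs
          by (simp add: a0_def a1_def a2_def a3_def Vs algebra_simps flip: power_mult power_add)
        ultimately show ?thesis by (simp add: algebra_simps flip: power_Suc power_add)
      qed
      moreover have "?g \<omega> = 0" if "\<omega> \<notin> A" using that by (simp add: a0_def a1_def a2_def a3_def)
      ultimately show ?case by (cases "\<omega> \<in> A") auto
    qed
    moreover have nn: "AE \<omega> in M. 0 \<le> - ?g \<omega>" using sgn by eventually_elim simp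
    moreover have "0 \<le> (\<integral>\<omega>. - ?g \<omega> \<partial>M)" using nn by (rule integral_nonneg_AE)
    moreover have "integrable M (\<lambda>\<omega>. - ?g \<omega>)" using i0 j1 j2 j3 by simp
    ultimately have "AE \<omega> in M. - ?g \<omega> = 0"
      using integral_nonneg_eq_0_iff_AE[of M "\<lambda>\<omega>. - ?g \<omega>"] by linarith
    then show ?thesis using sgn AE_space by eventually_elim (auto simp: A_def sp)
  qed
  \<comment> \<open>The truncation is removed: where V > u(c)^2, \<open>key\<close> makes
    \<open>N\<close> finite, so almost every such point lies in the truncated set for some
    \<open>m\<close>.\<close>
  then have "AE \<omega> in M. \<forall>m. \<not> ((u c)\<^sup>2 < V \<omega> \<and> V \<omega> \<le> real m \<and> N \<omega> \<le> ennreal (real m))"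
    by (simp add: AE_all_countable)
  then show ?thesis using key fin
  proof eventually_elim
    case (elim \<omega>)
    have "V \<omega> \<le> (u c)\<^sup>2"
    proof (rule ccontr)
      assume "\<not> ?thesis"
      then have *: "(u c)\<^sup>2 < V \<omega>" by simp
      then have "0 < V \<omega>" using u_pos[of c] by (meson less_trans zero_less_power)
      then have "N \<omega> < \<infinity>" using elim(2) by simp
      then obtain q where q: "N \<omega> = ennreal q" "q \<ge> 0" by (cases "N \<omega>") auto
      obtain m where "max (V \<omega>) q \<le> real m" using real_arch_simple by blast
      then show False using elim(1) * q by (auto dest!: spec[of _ m] intro: ennreal_leI)
    qed
    then show ?case using elim(3)
      by (metis V_def ennreal_enn2real ennreal_leI infinity_ennreal_def)
  qed
qed

end

section \<open>Martingales with differences bounded above\<close>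

text \<open>With \<open>w = maj_shift v h\<close> and \<open>\<alpha> = maj_coeff v h\<close>, the parabola \<open>\<alpha> (x + w)\<^sup>2\<close> dominates
  \<open>(x - h)\<^sub>+\<^sup>2\<close> on \<open>x \<le> 1\<close> and agrees with it at the two atoms \<open>- v\<close> and \<open>1\<close> of \<open>\<epsilon>(v)\<close>.\<close>

definition maj_shift :: "real \<Rightarrow> real \<Rightarrow> real" where
  "maj_shift v h = max v (- h)"

definition maj_coeff :: "real \<Rightarrow> real \<Rightarrow> real" where
  "maj_coeff v h = (min 1 (max 0 (1 - h) / (1 + v)))\<^sup>2"

text \<open>For h < -v the parabola is (x-h)^2 itself, and for h > 1 both sides vanish. In between
  it is the square of the line through (-v, 0) and (1, 1-h), which lies above x-h for x <=
  1.\<close>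

lemma max_square_le_parabola:
  assumes "x \<le> 1" "v > 0"
  shows "(max 0 (x - h))\<^sup>2 \<le> maj_coeff v h * (x + maj_shift v h)\<^sup>2"
proof -
  consider "h < - v" | "- v \<le> h" "h \<le> 1" | "1 < h" by linarith
  then show ?thesis
  proof cases
    case 1
    then have "maj_coeff v h = 1" "maj_shift v h = - h"
      using assms by (auto simp: maj_coeff_def maj_shift_def min_def field_simps)
    then show ?thesis by (simp add: max_def)
  next
    case 2
    then have *: "maj_coeff v h = ((1 - h) / (1 + v))\<^sup>2" "maj_shift v h = v"
      using assms by (auto simp: maj_coeff_def maj_shift_def min_def field_simps)
    show ?thesis
    proof (cases "x \<le> h")
      case True
      then show ?thesis by (simp add: max_def *)
    next
      case False
      have "(x - h) * (1 + v) \<le> (1 - h) * (x + v)"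
      proof -
        have "(1 - h) * (x + v) - (x - h) * (1 + v) = (1 - x) * (h + v)" by algebra
        moreover have "(1 - x) * (h + v) \<ge> 0" using 2 assms by simp
        ultimately show ?thesis by linarith
      qed
      then have "x - h \<le> (1 - h) / (1 + v) * (x + v)"
        using assms by (simp add: pos_le_divide_eq)
      then have "(x - h)\<^sup>2 \<le> ((1 - h) / (1 + v) * (x + v))\<^sup>2"
        using False by (intro power_mono) auto
      then show ?thesis using False unfolding * power_mult_distrib by (simp add: max_def)
    qed
  next
    case 3
    then have "max 0 (x - h) = 0" using assms by simp
    then show ?thesis by (simp add: maj_coeff_def)
  qed
qed

text \<open>The left side is the expectation of the parabola at a Bernoulli variable of mean 0 and
  variance \<open>v\<close>; the right side is that of the truncated square. They agree because the
  two functions coincide at both atoms.\<close>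

lemma parabola_expectation:
  assumes "v > 0"
  shows "maj_coeff v h * (v + (maj_shift v h)\<^sup>2) = ((max 0 (- h - v))\<^sup>2 + v * (max 0 (1 - h))\<^sup>2) / (1 + v)"
proof -
  have nz: "1 + v \<noteq> 0" using assms by simp
  consider "h < - v" | "- v \<le> h" "h \<le> 1" | "1 < h" by linarith
  then show ?thesis
  proof cases
    case 1
    then have "maj_coeff v h = 1" "maj_shift v h = - h" "max 0 (- h - v) = - h - v" "max 0 (1 - h) = 1 - h"
      using assms by (auto simp: maj_coeff_def maj_shift_def min_def field_simps)
    then show ?thesis using nz by (simp add: divide_simps) (simp add: algebra_simps power2_eq_square)
  next
    case 2
    then have *: "maj_coeff v h = ((1 - h) / (1 + v))\<^sup>2" "maj_shift v h = v" "max 0 (- h - v) = 0" "max 0 (1 - h) = 1 - h"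
      using assms by (auto simp: maj_coeff_def maj_shift_def min_def field_simps)
    show ?thesis unfolding * using nz
      by (simp add: power_divide divide_simps) (simp add: algebra_simps power2_eq_square)
  next
    case 3
    then show ?thesis using assms by (simp add: maj_coeff_def)
  qed
qed

lemma maj_coeff_bounds: "v > 0 \<Longrightarrow> 0 \<le> maj_coeff v h \<and> maj_coeff v h \<le> 1"
  unfolding maj_coeff_def by (auto intro!: power_le_one)

text \<open>Given \<open>F\<close>, the value of \<open>Y\<close> is frozen, so the parabola is used
  at the random level h - Y, with \<open>F\<close>-measurable coefficients. Its linear term
  integrates to 0, the conditional variance is replaced by its bound \<open>v\<close>, and
  \<open>parabola_expectation\<close> identifies the result with the Bernoulli expression.\<close>

lemma (in prob_space) expectation_max_square_step:
  assumes sub: "subalgebra M F" and X: "integrable M X" and X1: "AE \<omega> in M. X \<omega> \<le> 1"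
    and X0: "AE \<omega> in M. real_cond_exp M F X \<omega> = 0"
    and v: "v > 0" and var: "AE \<omega> in M. cond_var M F X \<omega> \<le> ennreal v"
    and Y: "Y \<in> borel_measurable F" and YC: "AE \<omega> in M. Y \<omega> \<le> C"
  shows "expectation (\<lambda>\<omega>. (max 0 (Y \<omega> + X \<omega> - h))\<^sup>2)
    \<le> bern v (\<lambda>h. expectation (\<lambda>\<omega>. (max 0 (Y \<omega> - h))\<^sup>2)) h"
proof -
  interpret finite_measure_subalgebra M F by unfold_locales (rule sub)
  note Y [measurable]
  have [measurable]: "X \<in> borel_measurable M" using X by simp
  have YM [measurable]: "Y \<in> borel_measurable M" by (rule measurable_from_subalg[OF sub Y])
  \<comment> \<open>Capping \<open>Y\<close> at \<open>C\<close> changes it only on a null set, but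
    it bounds the shift \<open>w\<close> everywhere, as the integrability lemma requires.\<close>
  define H where "H \<omega> = h - min C (Y \<omega>)" for \<omega>
  define a where "a \<omega> = maj_coeff v (H \<omega>)" for \<omega>
  define w where "w \<omega> = maj_shift v (H \<omega>)" for \<omega>
  have [measurable]: "a \<in> borel_measurable F" "w \<in> borel_measurable F"
    unfolding a_def[abs_def] w_def[abs_def] maj_coeff_def maj_shift_def H_def[abs_def] by measurable
  have a: "0 \<le> a \<omega>" "a \<omega> \<le> 1" for \<omega> using maj_coeff_bounds[OF v] by (auto simp: a_def)
  have w: "0 \<le> w \<omega>" "w \<omega> \<le> v + \<bar>C - h\<bar>" for \<omega> using v by (auto simp: w_def maj_shift_def H_def)
  have aw: "\<bar>2 * a \<omega> * w \<omega>\<bar> \<le> 2 * (v + \<bar>C - h\<bar>)" "\<bar>a \<omega> * (w \<omega>)\<^sup>2\<bar> \<le> (v + \<bar>C - h\<bar>)\<^sup>2" for \<omega>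
  proof -
    have "a \<omega> * w \<omega> \<le> 1 * (v + \<bar>C - h\<bar>)" using a[of \<omega>] w[of \<omega>] by (intro mult_mono) auto
    then show "\<bar>2 * a \<omega> * w \<omega>\<bar> \<le> 2 * (v + \<bar>C - h\<bar>)" using a[of \<omega>] w[of \<omega>] by simp
    have "a \<omega> * (w \<omega>)\<^sup>2 \<le> 1 * (v + \<bar>C - h\<bar>)\<^sup>2" using a[of \<omega>] w[of \<omega>] by (intro mult_mono power_mono) auto
    then show "\<bar>a \<omega> * (w \<omega>)\<^sup>2\<bar> \<le> (v + \<bar>C - h\<bar>)\<^sup>2" using a[of \<omega>] by simp
  qed
  have i2: "integrable M (\<lambda>\<omega>. a \<omega> * (X \<omega>)\<^sup>2)"
  proof (rule integrable_mult_of_nn_cond_exp_le)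
    show "AE \<omega> in M. ennreal \<bar>a \<omega>\<bar> *
      (nn_cond_exp M F (\<lambda>\<omega>. ennreal ((X \<omega>)\<^sup>2)) \<omega> + nn_cond_exp M F (\<lambda>\<omega>. ennreal (- (X \<omega>)\<^sup>2)) \<omega>) \<le> ennreal v"
      using var nn_cond_exp_neg_square[of X]
    proof eventually_elim
      case (elim \<omega>)
      have "ennreal (a \<omega>) * cond_var M F X \<omega> \<le> ennreal 1 * ennreal v"
        using elim(1) a[of \<omega>] by (intro mult_mono ennreal_leI) auto
      then show ?case using elim a[of \<omega>] by (simp add: cond_var_def)
    qed
  qed measurable
  have i1: "integrable M (\<lambda>\<omega>. 2 * a \<omega> * w \<omega> * X \<omega>)"
    using aw by (intro integrable_mult_bounded X) auto
  have i0: "integrable M (\<lambda>\<omega>. a \<omega> * (w \<omega>)\<^sup>2 * 1)"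
    using aw by (intro integrable_mult_bounded) auto
  have ia: "integrable M (\<lambda>\<omega>. a \<omega> * 1)"
    using a by (intro integrable_mult_bounded[where K=1]) auto
  have YX: "AE \<omega> in M. Y \<omega> + X \<omega> \<le> C + 1" using YC X1 by eventually_elim auto
  have "expectation (\<lambda>\<omega>. (max 0 (Y \<omega> + X \<omega> - h))\<^sup>2) \<le>
      expectation (\<lambda>\<omega>. a \<omega> * (X \<omega>)\<^sup>2 + 2 * a \<omega> * w \<omega> * X \<omega> + a \<omega> * (w \<omega>)\<^sup>2 * 1)"
  proof (rule integral_mono_AE)
    show "integrable M (\<lambda>\<omega>. (max 0 (Y \<omega> + X \<omega> - h))\<^sup>2)"
      using YX by (intro integrable_max_square) auto
    show "integrable M (\<lambda>\<omega>. a \<omega> * (X \<omega>)\<^sup>2 + 2 * a \<omega> * w \<omega> * X \<omega> + a \<omega> * (w \<omega>)\<^sup>2 * 1)"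
      using i0 i1 i2 by simp
    show "AE \<omega> in M. (max 0 (Y \<omega> + X \<omega> - h))\<^sup>2 \<le> a \<omega> * (X \<omega>)\<^sup>2 + 2 * a \<omega> * w \<omega> * X \<omega> + a \<omega> * (w \<omega>)\<^sup>2 * 1"
      using X1 YC
    proof eventually_elim
      case (elim \<omega>)
      have "(max 0 (X \<omega> - H \<omega>))\<^sup>2 \<le> a \<omega> * (X \<omega> + w \<omega>)\<^sup>2"
        unfolding a_def w_def using elim v by (intro max_square_le_parabola)
      moreover have "X \<omega> - H \<omega> = Y \<omega> + X \<omega> - h" using elim by (simp add: H_def)
      ultimately show ?case by (simp add: algebra_simps power2_eq_square)
    qed
  qed
  also have "\<dots> = expectation (\<lambda>\<omega>. a \<omega> * (X \<omega>)\<^sup>2) + expectation (\<lambda>\<omega>. 2 * a \<omega> * w \<omega> * X \<omega>)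
      + expectation (\<lambda>\<omega>. a \<omega> * (w \<omega>)\<^sup>2 * 1)"
    using i0 i1 i2 by simp
  also have "expectation (\<lambda>\<omega>. 2 * a \<omega> * w \<omega> * X \<omega>) = expectation (\<lambda>\<omega>. 2 * a \<omega> * w \<omega> * real_cond_exp M F X \<omega>)"
    using i1 by (intro real_cond_exp_intg(2)[symmetric]) auto
  also have "\<dots> = expectation (\<lambda>_. 0)"
  proof (rule integral_cong_AE)
    have [measurable]: "a \<in> borel_measurable M" "w \<in> borel_measurable M"
      by (auto intro: measurable_from_subalg[OF sub])
    show "(\<lambda>\<omega>. 2 * a \<omega> * w \<omega> * real_cond_exp M F X \<omega>) \<in> borel_measurable M" by measurable
  qed (use X0 in \<open>auto elim!: eventually_mono\<close>)
  also have "expectation (\<lambda>\<omega>. a \<omega> * (X \<omega>)\<^sup>2) = expectation (\<lambda>\<omega>. a \<omega> * real_cond_exp M F (\<lambda>\<omega>. (X \<omega>)\<^sup>2) \<omega>)"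
    using i2 by (intro real_cond_exp_intg(2)[symmetric]) auto
  also have "\<dots> \<le> expectation (\<lambda>\<omega>. v * (a \<omega> * 1))"
  proof (rule integral_mono_AE)
    show "integrable M (\<lambda>\<omega>. a \<omega> * real_cond_exp M F (\<lambda>\<omega>. (X \<omega>)\<^sup>2) \<omega>)"
      using i2 by (intro real_cond_exp_intg(1)) auto
    show "integrable M (\<lambda>\<omega>. v * (a \<omega> * 1))" using ia by simp
    show "AE \<omega> in M. a \<omega> * real_cond_exp M F (\<lambda>\<omega>. (X \<omega>)\<^sup>2) \<omega> \<le> v * (a \<omega> * 1)"
      using real_cond_exp_square[of X] var
    proof eventually_elim
      case (elim \<omega>)
      then have "real_cond_exp M F (\<lambda>\<omega>. (X \<omega>)\<^sup>2) \<omega> \<le> v" using v by (simp add: enn2real_leI)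
      then have "a \<omega> * real_cond_exp M F (\<lambda>\<omega>. (X \<omega>)\<^sup>2) \<omega> \<le> a \<omega> * v"
        using a(1) by (rule mult_left_mono)
      then show ?case by (simp add: mult.commute[of v])
    qed
  qed
  also have "expectation (\<lambda>\<omega>. v * (a \<omega> * 1)) + expectation (\<lambda>_. 0) + expectation (\<lambda>\<omega>. a \<omega> * (w \<omega>)\<^sup>2 * 1)
      = expectation (\<lambda>\<omega>. v * (a \<omega> * 1) + a \<omega> * (w \<omega>)\<^sup>2 * 1)"
    using i0 ia by simp
  also have "\<dots> = expectation (\<lambda>\<omega>. ((max 0 (Y \<omega> - (h + v)))\<^sup>2 + v * (max 0 (Y \<omega> - (h - 1)))\<^sup>2) / (1 + v))"
  proof (rule integral_cong_AE)
    have [measurable]: "a \<in> borel_measurable M" "w \<in> borel_measurable M"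
      by (auto intro: measurable_from_subalg[OF sub])
    show "(\<lambda>\<omega>. v * (a \<omega> * 1) + a \<omega> * (w \<omega>)\<^sup>2 * 1) \<in> borel_measurable M" by measurable
    show "AE \<omega> in M. v * (a \<omega> * 1) + a \<omega> * (w \<omega>)\<^sup>2 * 1 =
      ((max 0 (Y \<omega> - (h + v)))\<^sup>2 + v * (max 0 (Y \<omega> - (h - 1)))\<^sup>2) / (1 + v)"
      using YC
    proof eventually_elim
      case (elim \<omega>)
      then have H: "- H \<omega> - v = Y \<omega> - (h + v)" "1 - H \<omega> = Y \<omega> - (h - 1)" by (auto simp: H_def)
      have "v * (a \<omega> * 1) + a \<omega> * (w \<omega>)\<^sup>2 * 1 = a \<omega> * (v + (w \<omega>)\<^sup>2)" by (simp add: algebra_simps)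
      also have "\<dots> = ((max 0 (- H \<omega> - v))\<^sup>2 + v * (max 0 (1 - H \<omega>))\<^sup>2) / (1 + v)"
        unfolding a_def w_def by (rule parabola_expectation[OF v])
      finally show ?case unfolding H .
    qed
  qed measurable
  also have "\<dots> = bern v (\<lambda>h. expectation (\<lambda>\<omega>. (max 0 (Y \<omega> - h))\<^sup>2)) h"
    using integrable_max_square[OF YM YC] by (simp add: bern_def)
  finally show ?thesis by simp
qed

section \<open>Replacing the martingale differences one at a time\<close>

lemma (in prob_space) martingale_difference:
  assumes mart: "martingale_upto M n F (\<lambda>k \<omega>. \<Sum>i=1..k. X i \<omega>)" and "k \<in> {1..n}"
  shows "subalgebra M (F (k - 1))" "integrable M (X k)"
    "(\<lambda>\<omega>. \<Sum>i=1..k - 1. X i \<omega>) \<in> borel_measurable (F (k - 1))"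
    "AE \<omega> in M. real_cond_exp M (F (k - 1)) (X k) \<omega> = 0"
proof -
  let ?S = "\<lambda>k \<omega>. \<Sum>i=1..k. X i \<omega>"
  have k: "k - 1 \<le> k" "k \<le> n" "k - 1 \<le> n" using assms(2) by auto
  show sub: "subalgebra M (F (k - 1))" using mart k by (simp add: martingale_upto_def filtration_upto_def)
  interpret finite_measure_subalgebra M "F (k - 1)" by unfold_locales (rule sub)
  have X: "X k = (\<lambda>\<omega>. ?S k \<omega> - ?S (k - 1) \<omega>)" using assms(2) by (cases k) auto
  have int: "integrable M (?S k)" "integrable M (?S (k - 1))"
    and m: "?S (k - 1) \<in> borel_measurable (F (k - 1))"
    and c: "AE \<omega> in M. real_cond_exp M (F (k - 1)) (?S k) \<omega> = ?S (k - 1) \<omega>"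
    using mart k by (auto simp only: martingale_upto_def)
  show "?S (k - 1) \<in> borel_measurable (F (k - 1))" by (rule m)
  show "integrable M (X k)" unfolding X using int by simp
  show "AE \<omega> in M. real_cond_exp M (F (k - 1)) (X k) \<omega> = 0"
    unfolding X using real_cond_exp_diff[OF int] real_cond_exp_F_meas[OF int(2) m] c
    by eventually_elim simp
qed

text \<open>The induction peels off the last difference. The hypothesis is kept for every
  \<open>h\<close>, because \<open>bern\<close> evaluates the bound for the shorter sum at two
  shifted arguments; monotonicity of \<open>bern\<close> then carries it over.\<close>

lemma (in prob_space) expectation_max_square_martingale_le:
  assumes mart: "martingale_upto M n F (\<lambda>k \<omega>. \<Sum>i=1..k. X i \<omega>)"
    and X1: "\<And>k. k \<in> {1..n} \<Longrightarrow> AE \<omega> in M. X k \<omega> \<le> 1"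
    and v: "\<And>k. k \<in> {1..n} \<Longrightarrow> v k > 0"
    and var: "\<And>k. k \<in> {1..n} \<Longrightarrow> AE \<omega> in M. cond_var M (F (k - 1)) (X k) \<omega> \<le> ennreal (v k)"
    and "k \<le> n"
  shows "expectation (\<lambda>\<omega>. (max 0 ((\<Sum>i=1..k. X i \<omega>) - h))\<^sup>2)
    \<le> fold_mset bern pos_sq (image_mset v (mset_set {1..k})) h"
  using \<open>k \<le> n\<close>
proof (induction k arbitrary: h)
  case 0
  then show ?case by (simp add: pos_sq_def prob_space)
next
  case (Suc k)
  let ?S = "\<lambda>\<omega>. \<Sum>i=1..k. X i \<omega>"
  have k: "Suc k \<in> {1..n}" using Suc.prems by simp
  note diff = martingale_difference[OF mart k, simplified diff_Suc_1]
  have "AE \<omega> in M. \<forall>i\<in>{1..k}. X i \<omega> \<le> 1"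
    using Suc.prems by (intro AE_finite_allI X1) auto
  then have S: "AE \<omega> in M. ?S \<omega> \<le> real k"
  proof eventually_elim
    case (elim \<omega>)
    then have "?S \<omega> \<le> (\<Sum>i=1..k. 1)" by (intro sum_mono) auto
    then show ?case by simp
  qed
  have "expectation (\<lambda>\<omega>. (max 0 (?S \<omega> + X (Suc k) \<omega> - h))\<^sup>2)
      \<le> bern (v (Suc k)) (\<lambda>h. expectation (\<lambda>\<omega>. (max 0 (?S \<omega> - h))\<^sup>2)) h"
    by (rule expectation_max_square_step[OF diff(1,2) X1[OF k] diff(4) v[OF k]
          var[OF k, simplified diff_Suc_1] diff(3) S])
  also have "\<dots> \<le> bern (v (Suc k)) (fold_mset bern pos_sq (image_mset v (mset_set {1..k}))) h"
    using v[OF k] Suc.IH Suc.prems by (intro le_funD[OF bern_mono] le_funI) auto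
  finally show ?case by (simp add: atLeastAtMostSuc_conv add.commute)
qed

lemma (in prob_space) markov_max_square:
  assumes [measurable]: "Y \<in> borel_measurable M" and "AE \<omega> in M. Y \<omega> \<le> (C :: real)" and "h < x"
  shows "prob {\<omega> \<in> space M. x \<le> Y \<omega>} * (x - h)\<^sup>2 \<le> expectation (\<lambda>\<omega>. (max 0 (Y \<omega> - h))\<^sup>2)"
proof -
  let ?A = "{\<omega> \<in> space M. x \<le> Y \<omega>}"
  have "expectation (\<lambda>\<omega>. indicat_real ?A \<omega> * (x - h)\<^sup>2) \<le> expectation (\<lambda>\<omega>. (max 0 (Y \<omega> - h))\<^sup>2)"
  proof (rule integral_mono)
    show "integrable M (\<lambda>\<omega>. indicat_real ?A \<omega> * (x - h)\<^sup>2)"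
      by (intro integrable_mult_left integrable_real_indicator) (auto simp: emeasure_eq_measure)
    show "integrable M (\<lambda>\<omega>. (max 0 (Y \<omega> - h))\<^sup>2)"
      by (rule integrable_max_square[OF assms(1,2)])
  qed (use \<open>h < x\<close> in \<open>auto simp: indicator_def intro!: power_mono\<close>)
  then show ?thesis by simp
qed

text \<open>Summing c u(c) = 1 - u(c)^2 over all entries turns the numerator into n(1 - \<sigma>^2),
  where \<sigma>^2 is the averaged variance. The result is the skewness of \<epsilon>(\<sigma>^2)
  computed in \<open>bernoulli_rv_moments\<close>.\<close>

lemma avg_skew_eq:
  assumes "n \<ge> 1"
  shows "avg_var n g > 0" "avg_skew n g = (1 - avg_var n g) / sqrt (avg_var n g)"
proof -
  let ?U = "\<Sum>k=1..n. (u (g k))\<^sup>2"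
  have U: "?U > 0" using assms u_pos by (intro sum_pos) (auto simp: less_imp_neq[symmetric])
  then show "avg_var n g > 0" using assms by (simp add: avg_var_def)
  have "(\<Sum>k=1..n. g k * u (g k)) = (\<Sum>k=1..n. 1 - (u (g k))\<^sup>2)"
    using u_root by (intro sum.cong) (auto simp: algebra_simps)
  also have "\<dots> = n - ?U" by (simp add: sum_subtractf)
  finally have sum: "(\<Sum>k=1..n. g k * u (g k)) = n - ?U" .
  have U_eq: "?U = n * avg_var n g" using assms by (simp add: avg_var_def)
  then have *: "(\<Sum>k=1..n. g k * u (g k)) = n * (1 - avg_var n g)"
    unfolding sum by (simp add: right_diff_distrib)
  from U_eq show "avg_skew n g = (1 - avg_var n g) / sqrt (avg_var n g)"
    unfolding avg_skew_def * using assms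
    by (simp add: real_sqrt_mult flip: mult.assoc)
qed

lemma avg_const:
  assumes "n \<ge> 1" "\<And>k. k \<in> {1..n} \<Longrightarrow> g k = c"
  shows "avg_var n g = (u c)\<^sup>2" "avg_skew n g = c"
proof -
  have "(\<Sum>k=1..n. (u (g k))\<^sup>2) = (\<Sum>k=1..n. (u c)\<^sup>2)"
    by (rule sum.cong) (simp_all add: assms(2))
  then show v: "avg_var n g = (u c)\<^sup>2" using assms(1) by (simp add: avg_var_def)
  have "avg_skew n g = (1 - (u c)\<^sup>2) / u c"
    using u_pos[of c] by (simp add: avg_skew_eq(2)[OF assms(1)] v)
  also have "1 - (u c)\<^sup>2 = c * u c" using u_root[of c] by simp
  finally show "avg_skew n g = c" using u_pos[of c] by simp
qed


theorem theorem1p2: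
  fixes M :: "'a measure" and N :: "'b measure"
    and F :: "nat \<Rightarrow> 'a measure" and X :: "nat \<Rightarrow> 'a \<Rightarrow> real"
    and n :: nat and \<gamma>s :: "nat \<Rightarrow> real" and \<gamma> \<sigma>2 :: real
  assumes "prob_space M" and "prob_space N"
    and "n \<ge> 1"
    and "martingale_upto M n F (\<lambda>k \<omega>. \<Sum>i=1..k. X i \<omega>)"
    and "\<And>k. k \<in> {1..n} \<Longrightarrow> AE \<omega> in M. X k \<omega> \<le> 1"
    and "\<And>k. k \<in> {1..n} \<Longrightarrow> AE \<omega> in M. cond_var M (F (k - 1)) (X k) \<omega> < \<infinity>"
    and "\<And>k. k \<in> {1..n} \<Longrightarrow> AE \<omega> in M. ereal (\<gamma>s k) \<le> cond_skewness M (F (k - 1)) (X k) \<omega>"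
    and "\<gamma> = avg_skew n \<gamma>s"
    and "\<sigma>2 = avg_var n \<gamma>s"
  shows "\<sigma>2 > 0 \<and>
    (\<forall>\<epsilon>. bernoulli_rv N \<sigma>2 \<epsilon> \<longrightarrow>
       prob_space.expectation N \<epsilon> = 0 \<and> prob_space.variance N \<epsilon> = \<sigma>2 \<and> skewness N \<epsilon> = \<gamma>) \<and>
    (\<forall>\<epsilon> T. (\<forall>k\<in>{1..n}. bernoulli_rv N \<sigma>2 (\<epsilon> k)) \<longrightarrow>
       prob_space.indep_vars N (\<lambda>_. borel) \<epsilon> {1..n} \<longrightarrow>
       T = (\<lambda>\<omega>. \<Sum>k=1..n. \<epsilon> k \<omega>) \<longrightarrow>
       (\<forall>x::real.
          measure M {\<omega> \<in> space M. (\<Sum>k=1..n. X k \<omega>) \<ge> x}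
            \<le> (INF h\<in>{0<..}. exp (- h * x) * prob_space.expectation N (\<lambda>\<omega>. exp (h * T \<omega>))) \<and>
          measure M {\<omega> \<in> space M. (\<Sum>k=1..n. X k \<omega>) \<ge> x}
            \<le> (INF h\<in>{..<x}. (1 / (x - h)\<^sup>2) * prob_space.expectation N (\<lambda>\<omega>. (max 0 (T \<omega> - h))\<^sup>2)))) \<and>
    (\<forall>c. (\<forall>k\<in>{1..n}. \<gamma>s k = c) \<longrightarrow>
       \<gamma> = c \<and> \<sigma>2 = (u c)\<^sup>2 \<and>
       (\<forall>\<epsilon>. bernoulli_rv N \<sigma>2 \<epsilon> \<longrightarrow>
          skewness N \<epsilon> = c \<and> prob_space.variance N \<epsilon> = (u c)\<^sup>2))"
proof -
  interpret M: prob_space M by fact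
  interpret N: prob_space N by fact
  let ?S = "\<lambda>\<omega>. \<Sum>k=1..n. X k \<omega>"
  define v where "v k = (u (\<gamma>s k))\<^sup>2" for k
  have v: "v k > 0" for k using u_pos[of "\<gamma>s k"] by (simp add: v_def)
  have pos: "\<sigma>2 > 0" and skew: "\<gamma> = (1 - \<sigma>2) / sqrt \<sigma>2"
    using avg_skew_eq[OF assms(3)] assms(8,9) by auto
  have moments: "N.expectation \<epsilon> = 0" "N.variance \<epsilon> = \<sigma>2" "skewness N \<epsilon> = \<gamma>"
    if "bernoulli_rv N \<sigma>2 \<epsilon>" for \<epsilon>
    using N.bernoulli_rv_moments[OF that pos] skew by auto
  have var: "AE \<omega> in M. cond_var M (F (k - 1)) (X k) \<omega> \<le> ennreal (v k)" if k: "k \<in> {1..n}" for k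
  proof -
    note diff = M.martingale_difference[OF assms(4) k]
    interpret finite_measure_subalgebra M "F (k - 1)" by unfold_locales (rule diff(1))
    show ?thesis unfolding v_def
      by (rule cond_var_le_u_square[OF diff(2) assms(5)[OF k] diff(4) assms(6)[OF k] assms(7)[OF k]])
  qed
  have S_meas [measurable]: "?S \<in> borel_measurable M"
    using assms(4) by (auto simp: martingale_upto_def)
  have "AE \<omega> in M. \<forall>k\<in>{1..n}. X k \<omega> \<le> 1"
    using assms(5) by (intro AE_finite_allI) auto
  then have S_le: "AE \<omega> in M. ?S \<omega> \<le> real n"
  proof eventually_elim
    case (elim \<omega>)
    then have "?S \<omega> \<le> (\<Sum>k=1..n. 1)" by (intro sum_mono) auto
    then show ?case by simp
  qed
  have bound:
    "measure M {\<omega> \<in> space M. ?S \<omega> \<ge> x}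
       \<le> (INF h\<in>{0<..}. exp (- h * x) * N.expectation (\<lambda>\<omega>. exp (h * T \<omega>))) \<and>
     measure M {\<omega> \<in> space M. ?S \<omega> \<ge> x}
       \<le> (INF h\<in>{..<x}. (1 / (x - h)\<^sup>2) * N.expectation (\<lambda>\<omega>. (max 0 (T \<omega> - h))\<^sup>2))"
    if e: "\<forall>k\<in>{1..n}. bernoulli_rv N \<sigma>2 (\<epsilon> k)" and ind: "N.indep_vars (\<lambda>_. borel) \<epsilon> {1..n}"
      and T: "T = (\<lambda>\<omega>. \<Sum>k=1..n. \<epsilon> k \<omega>)" for \<epsilon> T and x :: real
  proof -
    let ?p = "measure M {\<omega> \<in> space M. x \<le> ?S \<omega>}"
    let ?V = "image_mset v (mset_set {1..n})"
    have T_meas [measurable]: "T \<in> borel_measurable N"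
      unfolding T using e by (intro borel_measurable_sum) (auto simp: bernoulli_rv_def)
    have T_le: "AE \<omega> in N. T \<omega> \<le> real n"
      unfolding T using e pos by (intro N.AE_sum_bernoulli_rv_le) auto
    have "sum_mset ?V = (\<Sum>k=1..n. (u (\<gamma>s k))\<^sup>2)"
      by (simp only: sum_unfold_sum_mset v_def[abs_def])
    then have "sum_mset ?V = real (size ?V) * \<sigma>2"
      using assms(3,9) by (simp add: avg_var_def)
    then have "fold_mset bern pos_sq ?V \<le> fold_mset bern pos_sq (replicate_mset (size ?V) \<sigma>2)"
      using v by (intro fold_bern_pos_sq_le_average) (auto simp: less_imp_le)
    then have avg: "fold_mset bern pos_sq ?V \<le> fold_mset bern pos_sq (replicate_mset n \<sigma>2)"
      by simp
    \<comment> \<open>The quadratic inequality for all h < x is the common source of both final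
      bounds: division gives the quadratic one, and the mixture lemma gives the exponential
      one.\<close>
    have le: "?p * (x - h)\<^sup>2 \<le> N.expectation (\<lambda>\<omega>. (max 0 (T \<omega> - h))\<^sup>2)" if "h < x" for h
    proof -
      have "?p * (x - h)\<^sup>2 \<le> M.expectation (\<lambda>\<omega>. (max 0 (?S \<omega> - h))\<^sup>2)"
        using that by (rule M.markov_max_square[OF S_meas S_le])
      also have "\<dots> \<le> fold_mset bern pos_sq ?V h"
        using assms(5) v var by (intro M.expectation_max_square_martingale_le[OF assms(4)]) auto
      also have "\<dots> \<le> fold_mset bern pos_sq (replicate_mset n \<sigma>2) h"
        by (rule le_funD[OF avg])
      also have "\<dots> = N.expectation (\<lambda>\<omega>. (max 0 (T \<omega> - h))\<^sup>2)"
        unfolding T using e pos ind by (intro N.expectation_max_square_sum_bernoulli_rv[symmetric]) auto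
      finally show ?thesis .
    qed
    have "?p \<le> (INF h\<in>{0<..}. exp (- h * x) * N.expectation (\<lambda>\<omega>. exp (h * T \<omega>)))"
    proof (rule cINF_greatest)
      fix h :: real assume "h \<in> {0<..}"
      then show "?p \<le> exp (- h * x) * N.expectation (\<lambda>\<omega>. exp (h * T \<omega>))"
        using le by (intro N.exp_bound_of_max_square_bound[OF T_meas T_le]) auto
    qed auto
    moreover have "?p \<le> (INF h\<in>{..<x}. (1 / (x - h)\<^sup>2) * N.expectation (\<lambda>\<omega>. (max 0 (T \<omega> - h))\<^sup>2))"
    proof (rule cINF_greatest)
      fix h assume "h \<in> {..<x}"
      then show "?p \<le> (1 / (x - h)\<^sup>2) * N.expectation (\<lambda>\<omega>. (max 0 (T \<omega> - h))\<^sup>2)"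
        using le[of h] by (simp add: field_simps)
    qed auto
    ultimately show ?thesis by blast
  qed
  have const: "\<gamma> = c \<and> \<sigma>2 = (u c)\<^sup>2" if "\<forall>k\<in>{1..n}. \<gamma>s k = c" for c
    using avg_const[OF assms(3), of \<gamma>s c] that assms(8,9) by auto
  show ?thesis
    using pos moments bound const by (intro conjI allI impI) (blast | metis)+
qed

end
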